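(* Let $d \geq 2$ and let $\Gamma \leq \operatorname{GL}_d(\mathbb{Z})$ be a subgroup such that (1) the linear action of $\Gamma$ on $\mathbb{R}^d$ is irreducible, and (2) there is a finite set $S \subset \Gamma$ of unipotent matrices generating $\Gamma$. Then for every set $B \subset \mathbb{Z}^d$ with $d^*(B) > 0$ and every integer $m \geq 1$ there exists a positive integer $k = k(B,m)$ such that: for all $a_1, \ldots, a_m \in k\mathbb{Z}^d$ there exist $\gamma_1, \ldots, \gamma_m \in \Gamma$ and $b \in B$ with $\{\gamma_1 a_1, \ldots, \gamma_m a_m\} \subset B - b$.
   Context: For $B \subset \mathbb{Z}^d$ the upper Banach density is $d^*(B) = \limsup_{R \to \infty} \sup_{x \in \mathbb{Z}^d} \frac{|B \cap (x + Q_R)|}{R^d}$, where $Q_R = [0,R)^d$ and $|\cdot|$ denotes cardinality. $B - b = \{ c - b : c \in B\}$. *)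

theory Defs
  imports "HOL-Analysis.Analysis"
begin

type_synonym 'n intmat = "int^'n^'n"

text \<open>Matrix powers (square integer matrices are not a monoid_mult instance).\<close>
primrec matpow :: "('n::finite) intmat \<Rightarrow> nat \<Rightarrow> 'n intmat" where
  "matpow A 0 = mat 1"
| "matpow A (Suc k) = A ** matpow A k"

definition unipotent :: "('n::finite) intmat \<Rightarrow> bool" where
  "unipotent A \<longleftrightarrow> (\<exists>N. matpow (A - mat 1) N = 0)"

definition is_subgroup_GL :: "('n::finite) intmat set \<Rightarrow> bool" where
  "is_subgroup_GL G \<longleftrightarrow> G \<subseteq> {A. invertible A} \<and> mat 1 \<in> G
     \<and> (\<forall>A\<in>G. \<forall>B\<in>G. A ** B \<in> G) \<and> (\<forall>A\<in>G. matrix_inv A \<in> G)"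

inductive_set generated_group :: "('n::finite) intmat set \<Rightarrow> 'n intmat set"
  for S where
  gen_one: "mat 1 \<in> generated_group S"
| gen_mult: "s \<in> S \<Longrightarrow> A \<in> generated_group S \<Longrightarrow> s ** A \<in> generated_group S"
| gen_inv: "s \<in> S \<Longrightarrow> A \<in> generated_group S \<Longrightarrow> matrix_inv s ** A \<in> generated_group S"

definition real_mat :: "('n::finite) intmat \<Rightarrow> real^'n^'n" where
  "real_mat A = (\<chi> i j. real_of_int (A$i$j))"

definition irreducible_action :: "('n::finite) intmat set \<Rightarrow> bool" where
  "irreducible_action G \<longleftrightarrow>
     (\<forall>W :: (real^'n) set. subspace W \<and> (\<forall>g\<in>G. \<forall>w\<in>W. real_mat g *v w \<in> W)
        \<longrightarrow> W = {0} \<or> W = UNIV)"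

definition cube :: "int^('n::finite) \<Rightarrow> nat \<Rightarrow> (int^'n) set" where
  "cube x R = {y. \<forall>i. x$i \<le> y$i \<and> y$i < x$i + int R}"

definition upper_banach_density :: "(int^('n::finite)) set \<Rightarrow> ereal" where
  "upper_banach_density B =
     limsup (\<lambda>R::nat. SUP x. ereal (real (card (B \<inter> cube x R)) / real R ^ CARD('n)))"

end

theory Submission
  imports Defs
begin

text \<open>
  Let \<open>M\<close> be a shift-invariant mean on bounded functions, obtained as a limit of averages over
  cubes in which \<open>B\<close> is dense, and let \<open>f\<close> be the indicator function of \<open>B\<close>.
  Convex combinations of translates of \<open>f\<close> by \<open>k * \<int>^d\<close> have an infimal \<open>L^2\<close> norm
  that increases with \<open>k\<close> along divisibility but stays bounded, so some \<open>k\<close> almost attains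
  the supremum. By the parallelogram law all combinations whose norm is close to that infimum are
  then close to one nearly \<open>k * \<int>^d\<close>-invariant function \<open>F\<close>.

  For nonzero \<open>a \<in> k * \<int>^d\<close>, the unipotent generators and irreducibility yield a
  polynomial path inside the orbit \<open>\<Gamma> a\<close> whose nonconstant coefficients span \<open>\<real>^d\<close>.
  Van der Corput differencing, with induction on the degree, shows that the averages of \<open>f\<close>
  along suitable subsequences of this path have almost minimal norm, hence are close to \<open>F\<close>.
  Therefore \<open>M (f * G\<^sub>1 * \<dots> * G\<^sub>m)\<close>, with \<open>G\<^sub>i\<close> such an average over
  \<open>\<Gamma> a\<^sub>i\<close>, is close to \<open>M (F ^ (m + 1)) \<ge> M f ^ (m + 1) > 0\<close>, and some term of the
  expanded product is positive.
\<close>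

section \<open>Semi-inner products and averages\<close>

text \<open>The dilation by \<open>k\<close> is forced: if \<open>B\<close> is a residue class
  modulo \<open>q\<close>, then \<open>B - b\<close> is \<open>q * \<int>^d\<close>, which no
  integer invertible matrix enters from outside. The difficulty is the order of choices:
  \<open>k\<close> is fixed before the vectors \<open>a\<^sub>i\<close>, while the path, its
  coefficient lattice and the step of the subsequence depend on them. Near-maximality of the energy
  over all further multiples \<open>k * k'\<close> settles this, because the index of the
  coefficient lattice is absorbed by \<open>k'\<close>; irreducibility is what makes that index
  finite. The mean is only finitely additive and its inner product only semidefinite. No completion
  or projection is formed: invariant components are replaced by near minimisers with explicit
  errors. The passage from \<open>M (f * F ^ m)\<close> to \<open>M (F ^ (m + 1))\<close> works
  because \<open>F\<close> is itself an average of translates of \<open>f\<close>: in the mean of a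
  translate of \<open>f\<close> against \<open>F ^ m\<close>, near-invariance of \<open>F\<close>
  lets every factor be translated along, and invariance of \<open>M\<close> then removes the
  translation.\<close>

locale semi_inner =
  fixes ip :: "'v::real_vector \<Rightarrow> 'v \<Rightarrow> real"
  assumes ip_add_left: "ip (x + y) z = ip x z + ip y z"
    and ip_scaleR_left: "ip (c *\<^sub>R x) z = c * ip x z"
    and ip_commute: "ip x y = ip y x"
    and ip_ge_zero: "0 \<le> ip x x"
begin

definition nm :: "'v \<Rightarrow> real" where "nm x = sqrt (ip x x)"

lemma ip_add_right: "ip z (x + y) = ip z x + ip z y"
  by (metis ip_add_left ip_commute)

lemma ip_scaleR_right: "ip z (c *\<^sub>R x) = c * ip z x"
  by (metis ip_scaleR_left ip_commute)

lemma ip_minus_left: "ip (- x) z = - ip x z"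
  using ip_scaleR_left[of "-1"] by simp

lemma ip_minus_right: "ip z (- x) = - ip z x"
  using ip_scaleR_right[of z "-1"] by simp

lemma ip_diff_left: "ip (x - y) z = ip x z - ip y z"
  using ip_add_left[of x "- y"] by (simp add: ip_minus_left)

lemma ip_diff_right: "ip z (x - y) = ip z x - ip z y"
  by (metis ip_diff_left ip_commute)

lemma ip_zero_left [simp]: "ip 0 z = 0"
  using ip_scaleR_left[of 0] by simp

lemma ip_zero_right [simp]: "ip z 0 = 0"
  using ip_scaleR_right[of z 0] by simp

lemma ip_sum_left: "ip (sum f A) z = (\<Sum>i\<in>A. ip (f i) z)"
  by (induction A rule: infinite_finite_induct) (auto simp: ip_add_left)

lemma ip_sum_right: "ip z (sum f A) = (\<Sum>i\<in>A. ip z (f i))"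
  by (induction A rule: infinite_finite_induct) (auto simp: ip_add_right)

lemmas ip_simps = ip_add_left ip_add_right ip_diff_left ip_diff_right
  ip_scaleR_left ip_scaleR_right ip_minus_left ip_minus_right

lemma nm_nonneg [simp]: "0 \<le> nm x"
  by (simp add: nm_def ip_ge_zero)

lemma nm_zero [simp]: "nm 0 = 0"
  by (simp add: nm_def)

lemma nm_square: "(nm x)\<^sup>2 = ip x x"
  by (simp add: nm_def ip_ge_zero)

lemma nm_scaleR: "nm (c *\<^sub>R x) = \<bar>c\<bar> * nm x"
proof -
  have "ip (c *\<^sub>R x) (c *\<^sub>R x) = c\<^sup>2 * ip x x"
    by (simp add: ip_simps power2_eq_square)
  then show ?thesis
    by (simp add: nm_def real_sqrt_mult)
qed

lemma nm_minus [simp]: "nm (- x) = nm x"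
  by (simp add: nm_def ip_simps)

lemma nm_diff_commute: "nm (x - y) = nm (y - x)"
  by (metis minus_diff_eq nm_minus)

lemma cauchy_schwarz: "\<bar>ip x y\<bar> \<le> nm x * nm y"
proof -
  have sq: "(ip x y)\<^sup>2 \<le> ip x x * ip y y"
  proof (cases "ip y y = 0")
    case True
    have "ip x y = 0"
    proof (rule ccontr)
      assume ne: "ip x y \<noteq> 0"
      \<comment> \<open>With \<open>ip y y = 0\<close> the quadratic in \<open>t\<close> degenerates
        to a linear one, and this \<open>t\<close> makes its value -1.\<close>
      define t where "t = - (ip x x + 1) / (2 * ip x y)"
      have "0 \<le> ip (x + t *\<^sub>R y) (x + t *\<^sub>R y)"
        by (rule ip_ge_zero)
      also have "\<dots> = ip x x + 2 * t * ip x y"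
        using True ip_commute[of x y] by (simp add: ip_simps)
      also have "\<dots> = -1"
        using ne by (simp add: t_def field_simps)
      finally show False by simp
    qed
    then show ?thesis
      using True by simp
  next
    case False
    then have pos: "0 < ip y y"
      using ip_ge_zero[of y] by simp
    define r where "r = ip x y / ip y y"
    have "0 \<le> ip (x - r *\<^sub>R y) (x - r *\<^sub>R y)"
      by (rule ip_ge_zero)
    also have "\<dots> = ip x x - (ip x y)\<^sup>2 / ip y y"
      using pos ip_commute[of x y]
      by (simp add: ip_simps r_def power2_eq_square)
    finally show ?thesis
      using pos by (simp add: field_simps)
  qed
  have "sqrt ((ip x y)\<^sup>2) \<le> sqrt (ip x x * ip y y)"
    using sq by (rule real_sqrt_le_mono)
  then show ?thesis
    by (simp add: nm_def real_sqrt_mult)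
qed

lemma nm_triangle: "nm (x + y) \<le> nm x + nm y"
proof (rule power2_le_imp_le)
  have "(nm (x + y))\<^sup>2 = (nm x)\<^sup>2 + 2 * ip x y + (nm y)\<^sup>2"
    using ip_commute[of x y] by (simp add: nm_square ip_simps)
  also have "\<dots> \<le> (nm x + nm y)\<^sup>2"
    using cauchy_schwarz[of x y] by (simp add: power2_sum)
  finally show "(nm (x + y))\<^sup>2 \<le> (nm x + nm y)\<^sup>2" .
qed simp

lemma nm_triangle_diff: "nm (x - z) \<le> nm (x - y) + nm (y - z)"
  using nm_triangle[of "x - y" "y - z"] by simp

lemma nm_triangle_minus: "nm (x - y) \<le> nm x + nm y"
  using nm_triangle[of x "- y"] by simp

lemma nm_le_add_diff: "nm x \<le> nm y + nm (x - y)"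
  using nm_triangle[of y "x - y"] by simp

lemma nm_sum: "nm (sum f A) \<le> (\<Sum>i\<in>A. nm (f i))"
proof (induction A rule: infinite_finite_induct)
  case (insert x F)
  then show ?case
    using nm_triangle[of "f x" "sum f F"] by simp
qed auto

lemma nm_convex:
  assumes "0 \<le> t" "t \<le> 1" "nm x \<le> c" "nm y \<le> c"
  shows "nm ((1 - t) *\<^sub>R x + t *\<^sub>R y) \<le> c"
proof -
  have "nm ((1 - t) *\<^sub>R x + t *\<^sub>R y) \<le> (1 - t) * nm x + t * nm y"
    using nm_triangle[of "(1 - t) *\<^sub>R x" "t *\<^sub>R y"] assms by (simp add: nm_scaleR)
  also have "\<dots> \<le> (1 - t) * c + t * c"
    using assms by (intro add_mono mult_left_mono) auto
  finally show ?thesis by (simp add: algebra_simps)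
qed

text \<open>The midpoint has energy at least \<open>e\<close>, so \<open>ip (u - v) (u - v)\<close>
  is at most \<open>2 (e + \<eta>) + 2 (e + \<eta>) - 4 e\<close>. This stands in for uniqueness of
  the minimiser in a closed convex set.\<close>

lemma parallelogram_near:
  assumes "e \<le> ip ((1/2) *\<^sub>R (u + v)) ((1/2) *\<^sub>R (u + v))"
    and "ip u u \<le> e + \<eta>" "ip v v \<le> e + \<eta>"
  shows "nm (u - v) \<le> 2 * sqrt \<eta>"
proof -
  have "4 * ip ((1/2) *\<^sub>R (u + v)) ((1/2) *\<^sub>R (u + v)) = ip (u + v) (u + v)"
    by (simp only: ip_scaleR_left ip_scaleR_right)
  moreover have "ip (u + v) (u + v) + ip (u - v) (u - v) = 2 * ip u u + 2 * ip v v"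
    by (simp add: ip_simps)
  ultimately have "ip (u - v) (u - v) \<le> 4 * \<eta>"
    using assms by (smt (verit))
  then have "sqrt (ip (u - v) (u - v)) \<le> sqrt (4 * \<eta>)"
    by (rule real_sqrt_le_mono)
  then show ?thesis
    by (simp add: nm_def real_sqrt_mult)
qed

definition avg :: "nat \<Rightarrow> (nat \<Rightarrow> 'v) \<Rightarrow> 'v" where
  "avg N x = (1 / real N) *\<^sub>R (\<Sum>n<N. x n)"

lemma avg_add: "avg N (\<lambda>n. x n + y n) = avg N x + avg N y"
  by (simp add: avg_def sum.distrib scaleR_add_right)

lemma avg_diff: "avg N (\<lambda>n. x n - y n) = avg N x - avg N y"
  by (simp add: avg_def sum_subtractf scaleR_diff_right)

lemma avg_scaleR: "avg N (\<lambda>n. c *\<^sub>R x n) = c *\<^sub>R avg N x"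
  by (simp add: avg_def scaleR_sum_right mult.commute)

lemma avg_const: "N > 0 \<Longrightarrow> avg N (\<lambda>n. v) = v"
  by (simp add: avg_def sum_constant_scaleR)

lemma nm_avg_le:
  assumes "\<And>n. n < N \<Longrightarrow> nm (x n) \<le> c" "0 \<le> c"
  shows "nm (avg N x) \<le> c"
proof (cases "N = 0")
  case False
  have "nm (\<Sum>n<N. x n) \<le> (\<Sum>n<N. nm (x n))"
    by (rule nm_sum)
  also have "\<dots> \<le> real N * c"
    using sum_bounded_above[of "{..<N}" "\<lambda>n. nm (x n)" c] assms by simp
  finally show ?thesis
    using False by (simp add: avg_def nm_scaleR field_simps)
qed (use assms in \<open>simp add: avg_def\<close>)

lemma nm_avg_shift:
  assumes "\<And>n. nm (x n) \<le> c"
  shows "nm (avg N (\<lambda>n. x (n + h)) - avg N x) \<le> 2 * real h * c / real N"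
proof (induction h)
  case (Suc h)
  have c: "0 \<le> c"
    using assms[of 0] nm_nonneg order_trans by blast
  have tel: "(\<Sum>n<N. x (n + Suc h)) - (\<Sum>n<N. x (n + h)) = x (N + h) - x h"
    using sum_lessThan_telescope[of "\<lambda>n. x (n + h)" N]
    by (simp add: sum_subtractf)
  have "nm (avg N (\<lambda>n. x (n + Suc h)) - avg N (\<lambda>n. x (n + h)))
      = (1 / real N) * nm (x (N + h) - x h)"
    unfolding avg_def scaleR_diff_right[symmetric] tel by (simp add: nm_scaleR)
  also have "\<dots> \<le> (1 / real N) * (2 * c)"
    using nm_triangle_minus[of "x (N + h)" "x h"] assms[of "N + h"] assms[of h]
    by (intro mult_left_mono) auto
  finally have "nm (avg N (\<lambda>n. x (n + Suc h)) - avg N (\<lambda>n. x (n + h))) \<le> 2 * c / real N"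
    by simp
  then show ?case
    using Suc nm_triangle_diff[of "avg N (\<lambda>n. x (n + Suc h))" "avg N x" "avg N (\<lambda>n. x (n + h))"]
    by (simp add: field_simps add_divide_distrib)
qed (simp add: avg_def)

lemma avg_avg_commute: "avg N (\<lambda>n. avg H (\<lambda>h. x h n)) = avg H (\<lambda>h. avg N (x h))"
proof -
  have "(\<Sum>n<N. \<Sum>h<H. x h n) = (\<Sum>h<H. \<Sum>n<N. x h n)"
    by (rule sum.swap)
  then show ?thesis
    by (simp add: avg_def scaleR_sum_right[symmetric])
qed

text \<open>The variance of the \<open>x n\<close> around their average is nonnegative.\<close>

lemma ip_avg_convex: "ip (avg N x) (avg N x) \<le> (1 / real N) * (\<Sum>n<N. ip (x n) (x n))"
proof (cases "N = 0")
  case False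
  let ?m = "avg N x"
  have s: "(\<Sum>n<N. x n) = real N *\<^sub>R ?m"
    using False by (simp add: avg_def)
  have "0 \<le> (\<Sum>n<N. ip (x n - ?m) (x n - ?m))"
    by (intro sum_nonneg ip_ge_zero)
  also have "\<dots> = (\<Sum>n<N. ip (x n) (x n)) - ip (\<Sum>n<N. x n) ?m - ip ?m (\<Sum>n<N. x n) + real N * ip ?m ?m"
    by (simp add: ip_simps sum.distrib sum_subtractf ip_sum_left ip_sum_right algebra_simps)
  also have "\<dots> = (\<Sum>n<N. ip (x n) (x n)) - real N * ip ?m ?m"
    unfolding s by (simp add: ip_simps)
  finally show ?thesis
    using False by (simp add: field_simps)
qed (simp add: avg_def)

end

section \<open>The van der Corput inequality\<close>

lemma eventually_div_le:
  fixes K \<epsilon> :: real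
  assumes "0 < \<epsilon>"
  shows "\<forall>\<^sub>F N in sequentially. K / real N \<le> \<epsilon>"
proof -
  have "(\<lambda>N. K / real N) \<longlonglongrightarrow> 0"
    by (rule lim_const_over_n)
  then have "\<forall>\<^sub>F N in sequentially. K / real N < \<epsilon>"
    using assms by (rule order_tendstoD)
  then show ?thesis
    by eventually_elim simp
qed

lemma mean_shift_le:
  fixes a :: "nat \<Rightarrow> real"
  assumes "\<And>n. \<bar>a n\<bar> \<le> K"
  shows "(1 / real N) * (\<Sum>n<N. a (n + h)) \<le> (1 / real N) * (\<Sum>n<N. a n) + 2 * real h * K / real N"
proof (induction h)
  case (Suc h)
  have "(\<Sum>n<N. a (n + Suc h)) - (\<Sum>n<N. a (n + h)) = a (N + h) - a h"
    using sum_lessThan_telescope[of "\<lambda>n. a (n + h)" N]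
    by (simp add: sum_subtractf)
  also have "\<dots> \<le> 2 * K"
    using assms[of "N + h"] assms[of h] by linarith
  finally have "(1 / real N) * (\<Sum>n<N. a (n + Suc h)) \<le> (1 / real N) * ((\<Sum>n<N. a (n + h)) + 2 * K)"
    by (intro mult_left_mono) auto
  then show ?case
    using Suc by (simp add: field_simps add_divide_distrib)
qed simp

context semi_inner
begin

text \<open>Averaging over a sliding window of length \<open>H\<close> barely changes a long
  average, while the square of the windowed average expands into \<open>H\<^sup>2\<close>
  correlations, of which only the \<open>H\<close> diagonal ones are not controlled by
  \<open>\<delta>\<close>.\<close>

lemma van_der_corput:
  assumes bd: "\<And>n. nm (x n) \<le> C"
    and corr: "\<And>h. h \<ge> 1 \<Longrightarrow>
      \<forall>\<^sub>F N in sequentially. \<bar>(1 / real N) * (\<Sum>n<N. ip (x (n + h)) (x n))\<bar> \<le> \<delta>"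
    and \<rho>: "\<rho> > 0"
  shows "\<forall>\<^sub>F N in sequentially. ip (avg N x) (avg N x) \<le> \<delta> + \<rho>"
proof -
  have C: "0 \<le> C"
    using bd[of 0] nm_nonneg order_trans by blast
  have \<delta>: "0 \<le> \<delta>"
  proof -
    obtain N where "\<bar>(1 / real N) * (\<Sum>n<N. ip (x (n + 1)) (x n))\<bar> \<le> \<delta>"
      using eventually_happens'[OF sequentially_bot corr[of 1]] by auto
    then show ?thesis by linarith
  qed
  \<comment> \<open>Three errors of size \<open>\<rho> / 3\<close> are allowed: the diagonal
    \<open>C\<^sup>2 / H\<close>, the change of lags in \<open>r_less\<close>, and the replacement
    of \<open>y\<close> by \<open>x\<close>.\<close>
  obtain H :: nat where H: "H > 0" "C\<^sup>2 / real H \<le> \<rho> / 3"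
  proof -
    have "\<forall>\<^sub>F H in sequentially. H > 0 \<and> C\<^sup>2 / real H \<le> \<rho> / 3"
      using eventually_div_le[of "\<rho> / 3" "C\<^sup>2"] eventually_gt_at_top[of 0] \<rho>
      by (simp add: eventually_conj_iff)
    then show ?thesis
      using that eventually_happens'[OF sequentially_bot] by blast
  qed
  define r where "r N h k = (1 / real N) * (\<Sum>n<N. ip (x (n + h)) (x (n + k)))" for N h k
  define y where "y n = avg H (\<lambda>h. x (n + h))" for n
  have ipC: "\<bar>ip (x i) (x j)\<bar> \<le> C\<^sup>2" for i j
  proof -
    have "\<bar>ip (x i) (x j)\<bar> \<le> nm (x i) * nm (x j)"
      by (rule cauchy_schwarz)
    also have "\<dots> \<le> C * C"
      using bd C by (intro mult_mono) auto
    finally show ?thesis by (simp add: power2_eq_square)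
  qed
  have r_commute: "r N h k = r N k h" for N h k
    unfolding r_def by (simp add: ip_commute)
  \<comment> \<open>Moving the summation index by \<open>k\<close> turns the lags
    \<open>(h, k)\<close> into \<open>(h - k, 0)\<close> up to boundary terms.\<close>
  have r_less: "\<forall>\<^sub>F N in sequentially. r N h k \<le> \<delta> + \<rho> / 3" if "k < h" for h k
  proof -
    have "\<forall>\<^sub>F N in sequentially. 2 * real k * C\<^sup>2 / real N \<le> \<rho> / 3"
      using \<rho> by (intro eventually_div_le) simp
    moreover have "\<forall>\<^sub>F N in sequentially.
        \<bar>(1 / real N) * (\<Sum>n<N. ip (x (n + (h - k))) (x n))\<bar> \<le> \<delta>"
      using that by (intro corr) simp
    ultimately show ?thesis
    proof eventually_elim
      case (elim N)
      have "r N h k \<le> (1 / real N) * (\<Sum>n<N. ip (x (n + (h - k))) (x n)) + 2 * real k * C\<^sup>2 / real N"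
        using mean_shift_le[of "\<lambda>n. ip (x (n + (h - k))) (x n)" "C\<^sup>2" N k] ipC that
        by (simp add: r_def algebra_simps)
      then show ?case
        using elim by linarith
    qed
  qed
  have r_all: "\<forall>\<^sub>F N in sequentially. \<forall>h\<in>{..<H}. \<forall>k\<in>{..<H}.
      r N h k \<le> (if h = k then C\<^sup>2 else 0) + (\<delta> + \<rho> / 3)"
  proof (intro eventually_ball_finite finite_lessThan ballI)
    fix h k :: nat
    consider "h = k" | "k < h" | "h < k" by linarith
    then show "\<forall>\<^sub>F N in sequentially. r N h k \<le> (if h = k then C\<^sup>2 else 0) + (\<delta> + \<rho> / 3)"
    proof cases
      case 1
      have "r N h h \<le> C\<^sup>2" for N
      proof (cases "N = 0")
        case False
        have "(\<Sum>n<N. ip (x (n + h)) (x (n + h))) \<le> real N * C\<^sup>2"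
          using sum_bounded_above[of "{..<N}" "\<lambda>n. ip (x (n + h)) (x (n + h))" "C\<^sup>2"] ipC abs_le_D1
          by (metis card_lessThan)
        then show ?thesis
          using False by (simp add: r_def field_simps)
      qed (simp add: r_def)
      then have "r N h k \<le> (if h = k then C\<^sup>2 else 0) + (\<delta> + \<rho> / 3)" for N
        using 1 \<delta> \<rho> by (simp add: add_increasing2)
      then show ?thesis by simp
    next
      case 2
      then show ?thesis using r_less by simp
    next
      case 3
      then show ?thesis using r_less[of h k] r_commute by simp
    qed
  qed
  have "\<forall>\<^sub>F N in sequentially. 4 * real H * C\<^sup>2 / real N \<le> \<rho> / 3"
    using \<rho> by (intro eventually_div_le) simp
  with r_all show ?thesis
  proof eventually_elim
    case (elim N)
    have ipy: "ip (y n) (y n) = (1 / (real H)\<^sup>2) * (\<Sum>h<H. \<Sum>k<H. ip (x (n + h)) (x (n + k)))" for n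
      by (simp add: y_def avg_def ip_simps ip_sum_left ip_sum_right power2_eq_square
          sum_distrib_left mult.assoc) (rule sum.swap)
    have "ip (avg N y) (avg N y) \<le> (1 / real N) * (\<Sum>n<N. ip (y n) (y n))"
      by (rule ip_avg_convex)
    also have "\<dots> = (1 / (real H)\<^sup>2) * (\<Sum>h<H. \<Sum>k<H. r N h k)"
    proof -
      have "(\<Sum>n<N. \<Sum>h<H. \<Sum>k<H. ip (x (n + h)) (x (n + k)))
          = (\<Sum>h<H. \<Sum>k<H. \<Sum>n<N. ip (x (n + h)) (x (n + k)))"
        by (subst sum.swap, rule sum.cong[OF refl], rule sum.swap)
      then show ?thesis
        unfolding ipy r_def by (simp add: sum_distrib_left[symmetric] sum_divide_distrib[symmetric])
    qed
    also have "\<dots> \<le> (1 / (real H)\<^sup>2) * (\<Sum>h<H. \<Sum>k<H. (if h = k then C\<^sup>2 else 0) + (\<delta> + \<rho> / 3))"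
      using elim by (intro mult_left_mono sum_mono) auto
    also have "\<dots> = C\<^sup>2 / real H + (\<delta> + \<rho> / 3)"
    proof -
      have "(\<Sum>h<H. \<Sum>k<H. (if h = k then C\<^sup>2 else 0) + (\<delta> + \<rho> / 3))
          = real H * C\<^sup>2 + (real H)\<^sup>2 * (\<delta> + \<rho> / 3)"
        by (simp only: sum.distrib) (simp add: power2_eq_square algebra_simps)
      then show ?thesis
        using H by (simp add: power2_eq_square field_simps)
    qed
    finally have qy: "ip (avg N y) (avg N y) \<le> \<delta> + 2 * \<rho> / 3"
      using H(2) by linarith
    have "avg N y - avg N x = avg H (\<lambda>h. avg N (\<lambda>n. x (n + h)) - avg N x)"
      unfolding y_def avg_avg_commute[of N H "\<lambda>h n. x (n + h)"] using H
      by (simp add: avg_diff avg_const)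
    moreover have "nm (avg H (\<lambda>h. avg N (\<lambda>n. x (n + h)) - avg N x)) \<le> 2 * real H * C / real N"
    proof (rule nm_avg_le)
      fix h assume "h < H"
      have "nm (avg N (\<lambda>n. x (n + h)) - avg N x) \<le> 2 * real h * C / real N"
        using bd by (rule nm_avg_shift)
      also have "\<dots> \<le> 2 * real H * C / real N"
        using \<open>h < H\<close> C by (intro divide_right_mono mult_right_mono) auto
      finally show "nm (avg N (\<lambda>n. x (n + h)) - avg N x) \<le> 2 * real H * C / real N" .
    qed (use C in auto)
    ultimately have d: "nm (avg N x - avg N y) \<le> 2 * real H * C / real N"
      by (metis nm_diff_commute)
    have nx: "nm (avg N x) \<le> C"
      using bd C by (intro nm_avg_le) auto
    have "nm (y n) \<le> C" for n
      unfolding y_def using bd C by (intro nm_avg_le) auto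
    then have ny: "nm (avg N y) \<le> C"
      using C by (intro nm_avg_le) auto
    \<comment> \<open>A difference of squares, written as a product, inherits the smallness of
      \<open>avg N x - avg N y\<close>.\<close>
    have "ip (avg N x) (avg N x) - ip (avg N y) (avg N y) = ip (avg N x - avg N y) (avg N x + avg N y)"
      using ip_commute[of "avg N x" "avg N y"] by (simp add: ip_simps)
    also have "\<dots> \<le> nm (avg N x - avg N y) * nm (avg N x + avg N y)"
      using cauchy_schwarz abs_le_D1 by blast
    also have "\<dots> \<le> (2 * real H * C / real N) * (C + C)"
      using d nx ny nm_triangle[of "avg N x" "avg N y"] C by (intro mult_mono) auto
    also have "\<dots> = 4 * real H * C\<^sup>2 / real N"
      by (simp add: power2_eq_square)
    finally show ?case
      using qy elim by linarith
  qed
qed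

end

section \<open>Averages of unitary actions along polynomial paths\<close>

definition scal :: "nat \<Rightarrow> (int^('n::finite)) set \<Rightarrow> (int^'n) set" where
  "scal k L = (\<lambda>x. int k *s x) ` L"

text \<open>Index 0 is left out: the constant coefficient of a path acts as one fixed isometry and
  does not change the norm of an average.\<close>

definition lattice_span :: "(nat \<Rightarrow> int^('n::finite)) \<Rightarrow> nat \<Rightarrow> (int^'n) set" where
  "lattice_span ws J = range (\<lambda>c :: nat \<Rightarrow> int. \<Sum>j=1..J. c j *s ws j)"

definition pval :: "(nat \<Rightarrow> int^('n::finite)) \<Rightarrow> nat \<Rightarrow> nat \<Rightarrow> int^'n" where
  "pval ws J n = (\<Sum>j\<le>J. (int n ^ j) *s ws j)"

text \<open>Differencing lowers the degree by one, and for \<open>h > 0\<close> the new leading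
  coefficient is a positive multiple of the old one, so its direction survives repeated van der
  Corput steps.\<close>

lemma pval_difference:
  "\<exists>ws'. (\<forall>n. pval ws (Suc J) (n + h) - pval ws (Suc J) n = pval ws' J n)
     \<and> ws' J = int (Suc J * h) *s ws (Suc J)"
proof -
  define ws' where "ws' i = (\<Sum>j=Suc i..Suc J. (int (j choose i) * int h ^ (j - i)) *s ws j)" for i
  have "(\<Sum>j\<le>Suc J. int (n + h) ^ j * ws j $ l) - (\<Sum>j\<le>Suc J. int n ^ j * ws j $ l)
      = (\<Sum>i\<le>J. int n ^ i * ws' i $ l)" for n l
  proof -
    let ?t = "\<lambda>j i. int (j choose i) * int n ^ i * int h ^ (j - i) * ws j $ l"
    have "int (n + h) ^ j * ws j $ l = (\<Sum>i<j. ?t j i) + int n ^ j * ws j $ l" for j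
      by (simp add: binomial_ring lessThan_Suc_atMost[symmetric] sum_distrib_right distrib_right)
    then have "(\<Sum>j\<le>Suc J. int (n + h) ^ j * ws j $ l) - (\<Sum>j\<le>Suc J. int n ^ j * ws j $ l)
        = (\<Sum>j\<le>Suc J. \<Sum>i<j. ?t j i)"
      by (simp add: sum.distrib del: sum.atMost_Suc)
    also have "\<dots> = (\<Sum>i<Suc J. \<Sum>j=Suc i..Suc J. ?t j i)"
      by (rule sum.nested_swap')
    also have "\<dots> = (\<Sum>i\<le>J. int n ^ i * ws' i $ l)"
      by (simp add: ws'_def lessThan_Suc_atMost sum_distrib_left ac_simps
          del: sum.cl_ivl_Suc sum.atMost_Suc)
    finally show ?thesis .
  qed
  then have "\<forall>n. pval ws (Suc J) (n + h) - pval ws (Suc J) n = pval ws' J n"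
    by (simp add: vec_eq_iff pval_def del: sum.atMost_Suc)
  moreover have "ws' J = int (Suc J * h) *s ws (Suc J)"
    by (simp add: ws'_def vec_eq_iff algebra_simps)
  ultimately show ?thesis by blast
qed

lemma pval_scale: "pval ws J (k * n) = pval (\<lambda>j. (int k ^ j) *s ws j) J n"
  by (simp add: pval_def vec_eq_iff power_mult_distrib ac_simps)

locale unitary_action = semi_inner ip
  for ip :: "'v::real_vector \<Rightarrow> 'v \<Rightarrow> real" +
  fixes U :: "int^('n::finite) \<Rightarrow> 'v \<Rightarrow> 'v"
  assumes U_add: "U x (v + w) = U x v + U x w"
    and U_scaleR: "U x (c *\<^sub>R v) = c *\<^sub>R U x v"
    and U_plus: "U (x + y) v = U x (U y v)"
    and U_zero: "U 0 v = v"
    and U_ip: "ip (U x v) (U x w) = ip v w"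
begin

lemma U_minus: "U x (- v) = - U x v"
  using U_scaleR[of x "-1"] by simp

lemma U_diff: "U x (v - w) = U x v - U x w"
  using U_add[of x v "- w"] by (simp add: U_minus)

lemma U_commute: "U x (U y v) = U y (U x v)"
  by (metis U_plus add.commute)

lemma U_sum: "U x (sum g A) = (\<Sum>i\<in>A. U x (g i))"
proof (induction A rule: infinite_finite_induct)
  have "U x (0 *\<^sub>R 0) = 0 *\<^sub>R U x 0"
    by (rule U_scaleR)
  then have z: "U x 0 = 0" by simp
  {
    case (infinite A)
    then show ?case using z by simp
  next
    case empty
    then show ?case using z by simp
  next
    case (insert y F)
    then show ?case by (simp add: U_add)
  }
qed

lemma nm_U [simp]: "nm (U x v) = nm v"
  by (simp add: nm_def U_ip)

lemma U_avg: "U x (avg N g) = avg N (\<lambda>n. U x (g n))"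
  by (simp add: avg_def U_scaleR U_sum)

text \<open>Convex combinations of the operators \<open>U x\<close> with \<open>x \<in> D\<close>; rule induction takes the
  place of computations with finite weighted sums.\<close>
inductive avop :: "(int^'n) set \<Rightarrow> ('v \<Rightarrow> 'v) \<Rightarrow> bool" for D where
  avop_base: "x \<in> D \<Longrightarrow> avop D (U x)"
| avop_conv: "avop D S \<Longrightarrow> avop D T \<Longrightarrow> 0 \<le> t \<Longrightarrow> t \<le> 1
     \<Longrightarrow> avop D (\<lambda>v. (1 - t) *\<^sub>R S v + t *\<^sub>R T v)"

lemma avop_add: "avop D T \<Longrightarrow> T (v + w) = T v + T w"
  by (induction rule: avop.induct) (simp_all add: U_add algebra_simps)

lemma avop_scaleR: "avop D T \<Longrightarrow> T (c *\<^sub>R v) = c *\<^sub>R T v"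
  by (induction rule: avop.induct) (simp_all add: U_scaleR algebra_simps)

lemma avop_U: "avop D T \<Longrightarrow> T (U x v) = U x (T v)"
  by (induction rule: avop.induct) (simp_all add: U_add U_scaleR U_commute)

lemma avop_commute: "avop D S \<Longrightarrow> avop E T \<Longrightarrow> S (T v) = T (S v)"
  by (induction rule: avop.induct) (simp_all add: avop_U avop_add avop_scaleR)

lemma avop_nm: "avop D T \<Longrightarrow> nm (T v) \<le> nm v"
  by (induction rule: avop.induct) (simp_all add: nm_convex)

lemma avop_mono: "avop D T \<Longrightarrow> D \<subseteq> E \<Longrightarrow> avop E T"
  by (induction rule: avop.induct) (auto intro: avop.intros)

text \<open>With \<open>D = E\<close> closed under addition of \<open>x\<close>, a translate of a
  near minimiser competes for the same infimum; this yields near-invariance.\<close>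

lemma avop_shift:
  assumes "avop D T" "\<And>y. y \<in> D \<Longrightarrow> x + y \<in> E"
  shows "avop E (\<lambda>v. U x (T v))"
  using assms
proof (induction rule: avop.induct)
  case (avop_base y)
  then have "avop E (U (x + y))"
    by (intro avop.avop_base)
  moreover have "U (x + y) = (\<lambda>v. U x (U y v))"
    by (simp add: U_plus fun_eq_iff)
  ultimately show ?case by simp
next
  case (avop_conv S T t)
  then show ?case
    by (simp add: U_add U_scaleR avop.avop_conv)
qed

lemma avop_avg:
  assumes "\<And>n. p n \<in> D" "N > 0"
  shows "avop D (\<lambda>v. avg N (\<lambda>n. U (p n) v))"
  using \<open>N > 0\<close>
proof (induction N rule: nat_induct_non_zero)
  case 1
  have "(\<lambda>v. avg 1 (\<lambda>n. U (p n) v)) = U (p 0)"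
    by (simp add: avg_def fun_eq_iff)
  then show ?case
    using assms avop_base by simp
next
  case (Suc N)
  \<comment> \<open>The weight of the newest term; scaling the old average by \<open>1 - t\<close>
    restores equal weights.\<close>
  define t where "t = 1 / real (Suc N)"
  have t: "1 - t = real N * t"
    by (simp add: t_def field_simps)
  have "avop D (\<lambda>v. (1 - t) *\<^sub>R avg N (\<lambda>n. U (p n) v) + t *\<^sub>R U (p N) v)"
    by (rule avop_conv[OF Suc.IH avop_base[OF assms(1)]]) (auto simp: t_def)
  moreover have "(\<lambda>v. (1 - t) *\<^sub>R avg N (\<lambda>n. U (p n) v) + t *\<^sub>R U (p N) v)
      = (\<lambda>v. avg (Suc N) (\<lambda>n. U (p n) v))"
    using Suc.hyps by (simp add: fun_eq_iff avg_def t scaleR_add_right) (simp add: t_def)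
  ultimately show ?case by simp
qed

section \<open>Minimal energy of averages and near minimisers\<close>

definition energy :: "(int^'n) set \<Rightarrow> 'v \<Rightarrow> real" where
  "energy D f = Inf ((\<lambda>T. ip (T f) (T f)) ` {T. avop D T})"

lemma energy_le: "avop D T \<Longrightarrow> energy D f \<le> ip (T f) (T f)"
  unfolding energy_def by (rule cInf_lower) (auto intro!: bdd_belowI[of _ 0] ip_ge_zero)

lemma energy_near:
  assumes "x \<in> D" "\<eta> > 0"
  obtains T where "avop D T" "ip (T f) (T f) \<le> energy D f + \<eta>"
proof -
  have ne: "(\<lambda>T. ip (T f) (T f)) ` {T. avop D T} \<noteq> {}"
    using avop_base[OF assms(1)] by blast
  have less: "Inf ((\<lambda>T. ip (T f) (T f)) ` {T. avop D T}) < energy D f + \<eta>"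
    unfolding energy_def using assms(2) by simp
  obtain T where "avop D T" "ip (T f) (T f) < energy D f + \<eta>"
    using cInf_lessD[OF ne less] by auto
  then show thesis
    using that[of T] by simp
qed

text \<open>The midpoint of two admissible operators is admissible, so its energy cannot undercut
  the infimum.\<close>

lemma energy_close:
  assumes "avop D S" "avop D T"
    and "ip (S f) (S f) \<le> energy D f + \<eta>" "ip (T f) (T f) \<le> energy D f + \<eta>"
  shows "nm (S f - T f) \<le> 2 * sqrt \<eta>"
proof (rule parallelogram_near)
  have "avop D (\<lambda>v. (1 - 1/2) *\<^sub>R S v + (1/2) *\<^sub>R T v)"
    using assms by (intro avop_conv) auto
  from energy_le[OF this, of f]
  show "energy D f \<le> ip ((1/2) *\<^sub>R (S f + T f)) ((1/2) *\<^sub>R (S f + T f))"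
    by (simp add: scaleR_add_right)
qed (use assms in auto)

text \<open>Since \<open>0 \<in> L\<close>, the identity is among the operators and bounds every
  infimum by \<open>ip f f\<close>; hence the supremum over \<open>k\<close> is finite, and a
  \<open>k\<close> within \<open>\<eta>\<close> of it works.\<close>

lemma energy_stable:
  assumes "0 \<in> L" "\<eta> > 0"
  obtains k :: nat where "k \<ge> 1"
    "\<And>k'. k' \<ge> 1 \<Longrightarrow> energy (scal (k * k') L) f \<le> energy (scal k L) f + \<eta>"
proof -
  let ?X = "(\<lambda>k. energy (scal k L) f) ` {1..}"
  have z: "0 \<in> scal k L" for k
    using assms(1) by (auto simp: scal_def image_iff intro!: bexI[of _ 0])
  have "energy (scal k L) f \<le> ip f f" for k
    using energy_le[OF avop_base[OF z], of k f] by (simp add: U_zero)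
  then have bdd: "bdd_above ?X"
    by (intro bdd_aboveI[of _ "ip f f"]) auto
  have "?X \<noteq> {}" by auto
  then obtain z where "z \<in> ?X" "Sup ?X - \<eta> < z"
    using less_cSupE[of "Sup ?X - \<eta>" ?X] assms(2) by force
  then obtain k where k: "k \<ge> 1" "Sup ?X - \<eta> < energy (scal k L) f"
    by auto
  show ?thesis
  proof
    fix k' :: nat assume "k' \<ge> 1"
    then have "energy (scal (k * k') L) f \<in> ?X"
      using k by (intro imageI) simp
    then have "energy (scal (k * k') L) f \<le> Sup ?X"
      using bdd by (rule cSup_upper)
    then show "energy (scal (k * k') L) f \<le> energy (scal k L) f + \<eta>"
      using k by simp
  qed (use k in simp)
qed

text \<open>The \<open>\<delta>\<close> depends only on \<open>\<epsilon>\<close> and the degree.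
  The induction needs this uniformity in the leading coefficient, since differencing by
  \<open>h\<close> multiplies \<open>c\<close> by the degree times \<open>h\<close>. The bound 2 is
  made for a difference of two vectors of norm at most 1.\<close>

lemma polynomial_average_small:
  assumes "\<epsilon> > 0"
  shows "\<exists>\<delta>>0. \<forall>g w ws. \<forall>c\<ge>1. nm g \<le> 2 \<longrightarrow> ws (Suc J) = int c *s w \<longrightarrow>
      (\<forall>c\<ge>1. \<forall>\<^sub>F N in sequentially. nm (avg N (\<lambda>n. U (int (n * c) *s w) g)) \<le> \<delta>) \<longrightarrow>
      (\<forall>\<^sub>F N in sequentially. nm (avg N (\<lambda>n. U (pval ws (Suc J) n) g)) \<le> \<epsilon>)"
  using assms
proof (induction J arbitrary: \<epsilon>)
  case 0
  show ?case
  proof (intro exI[of _ \<epsilon>] conjI allI impI)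
    fix g w c and ws :: "nat \<Rightarrow> int^'n"
    assume c: "1 \<le> c" and ws: "ws (Suc 0) = int c *s w"
      and *: "\<forall>c\<ge>1. \<forall>\<^sub>F N in sequentially. nm (avg N (\<lambda>n. U (int (n * c) *s w) g)) \<le> \<epsilon>"
    have "pval ws (Suc 0) n = ws 0 + int (n * c) *s w" for n
      by (simp add: pval_def ws vec_eq_iff)
    then have "avg N (\<lambda>n. U (pval ws (Suc 0) n) g) = U (ws 0) (avg N (\<lambda>n. U (int (n * c) *s w) g))" for N
      by (simp only: U_plus U_avg)
    then show "\<forall>\<^sub>F N in sequentially. nm (avg N (\<lambda>n. U (pval ws (Suc 0) n) g)) \<le> \<epsilon>"
      using * c by (simp del: of_nat_mult)
  qed (use 0 in auto)
next
  case (Suc J)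
  have pos: "\<epsilon>\<^sup>2 / 4 > 0"
    using Suc.prems by simp
  obtain \<delta> where \<delta>: "\<delta> > 0" and IH: "\<And>g w ws c. c \<ge> 1 \<Longrightarrow> nm g \<le> 2 \<Longrightarrow> ws (Suc J) = int c *s w \<Longrightarrow>
    (\<forall>c\<ge>1. \<forall>\<^sub>F N in sequentially. nm (avg N (\<lambda>n. U (int (n * c) *s w) g)) \<le> \<delta>) \<Longrightarrow>
    (\<forall>\<^sub>F N in sequentially. nm (avg N (\<lambda>n. U (pval ws (Suc J) n) g)) \<le> \<epsilon>\<^sup>2 / 4)"
    using Suc.IH[OF pos] by blast
  show ?case
  proof (intro exI[of _ \<delta>] conjI allI impI)
    fix g w c and ws :: "nat \<Rightarrow> int^'n"
    assume c: "1 \<le> c" and g: "nm g \<le> 2" and ws: "ws (Suc (Suc J)) = int c *s w"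
      and *: "\<forall>c\<ge>1. \<forall>\<^sub>F N in sequentially. nm (avg N (\<lambda>n. U (int (n * c) *s w) g)) \<le> \<delta>"
    let ?x = "\<lambda>n. U (pval ws (Suc (Suc J)) n) g"
    have "\<forall>\<^sub>F N in sequentially. ip (avg N ?x) (avg N ?x) \<le> \<epsilon>\<^sup>2 / 2 + \<epsilon>\<^sup>2 / 2"
    \<comment> \<open>Each correlation is at most \<open>\<epsilon>\<^sup>2 / 4\<close> times
      \<open>nm g \<le> 2\<close>; the other \<open>\<epsilon>\<^sup>2 / 2\<close> is the slack
      \<open>\<rho>\<close>.\<close>
    proof (rule van_der_corput)
      fix h :: nat assume h: "h \<ge> 1"
      obtain ws' where d: "\<And>n. pval ws (Suc (Suc J)) (n + h) - pval ws (Suc (Suc J)) n = pval ws' (Suc J) n"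
        and top: "ws' (Suc J) = int (Suc (Suc J) * h) *s ws (Suc (Suc J))"
        using pval_difference[of ws "Suc J" h] by blast
      have "ws' (Suc J) = int (Suc (Suc J) * h * c) *s w"
        by (simp add: top ws vec_eq_iff algebra_simps)
      from IH[of "Suc (Suc J) * h * c" g ws' w, OF _ g this *] h c
      have "\<forall>\<^sub>F N in sequentially. nm (avg N (\<lambda>n. U (pval ws' (Suc J) n) g)) \<le> \<epsilon>\<^sup>2 / 4"
        by simp
      then show "\<forall>\<^sub>F N in sequentially. \<bar>(1 / real N) * (\<Sum>n<N. ip (?x (n + h)) (?x n))\<bar> \<le> \<epsilon>\<^sup>2 / 2"
      proof eventually_elim
        case (elim N)
        have "ip (?x (n + h)) (?x n) = ip (U (pval ws' (Suc J) n) g) g" for n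
        proof -
          have "pval ws (Suc (Suc J)) (n + h) = pval ws (Suc (Suc J)) n + pval ws' (Suc J) n"
            using d[of n] by (simp add: algebra_simps)
          then show ?thesis
            by (simp add: U_plus U_ip)
        qed
        then have "(1 / real N) * (\<Sum>n<N. ip (?x (n + h)) (?x n))
            = ip (avg N (\<lambda>n. U (pval ws' (Suc J) n) g)) g"
          by (simp add: avg_def ip_simps ip_sum_left)
        also have "\<bar>\<dots>\<bar> \<le> nm (avg N (\<lambda>n. U (pval ws' (Suc J) n) g)) * nm g"
          by (rule cauchy_schwarz)
        also have "\<dots> \<le> \<epsilon>\<^sup>2 / 4 * 2"
          using elim g pos by (intro mult_mono) auto
        finally show ?case by simp
      qed
    qed (use g pos in auto)
    then show "\<forall>\<^sub>F N in sequentially. nm (avg N ?x) \<le> \<epsilon>"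
    proof eventually_elim
      case (elim N)
      then have "(nm (avg N ?x))\<^sup>2 \<le> \<epsilon>\<^sup>2"
        by (simp add: nm_square)
      then show ?case
        using Suc.prems by (rule power2_le_imp_le[OF _ less_imp_le])
    qed
  qed (fact \<delta>)
qed

end

section \<open>Closure properties of lattices and their dilates\<close>

lemma zero_in_lattice_span [simp]: "0 \<in> lattice_span ws J"
  unfolding lattice_span_def by (rule image_eqI[of _ _ "\<lambda>_. 0"]) (simp_all add: vec_eq_iff)

lemma zero_in_scal: "0 \<in> L \<Longrightarrow> 0 \<in> scal k L"
  unfolding scal_def by (rule image_eqI[of _ _ 0]) simp_all

lemma scal_mult_subset:
  assumes "\<And>(z::int) x. x \<in> L \<Longrightarrow> z *s x \<in> L"
  shows "scal (k * k') L \<subseteq> scal k L"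
proof
  fix y assume "y \<in> scal (k * k') L"
  then obtain x where x: "x \<in> L" "y = int (k * k') *s x"
    unfolding scal_def by blast
  from assms[OF x(1)] have "int k' *s x \<in> L" .
  moreover have "y = int k *s (int k' *s x)"
    by (simp add: x vector_smult_assoc)
  ultimately show "y \<in> scal k L"
    unfolding scal_def by blast
qed

lemma lattice_span_smult: "x \<in> lattice_span ws J \<Longrightarrow> (z::int) *s x \<in> lattice_span ws J"
proof -
  assume "x \<in> lattice_span ws J"
  then obtain c where "x = (\<Sum>j=1..J. c j *s ws j)"
    by (auto simp: lattice_span_def)
  then have "z *s x = (\<Sum>j=1..J. (z * c j) *s ws j)"
    by (simp add: vec_eq_iff sum_distrib_left mult.assoc)
  then show ?thesis
    by (auto simp: lattice_span_def)
qed

definition line :: "int^('n::finite) \<Rightarrow> (int^'n) set" where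
  "line w = range (\<lambda>j. j *s w)"

lemma line_smult: "x \<in> line w \<Longrightarrow> (z::int) *s x \<in> line w"
  by (auto simp: line_def vector_smult_assoc)

lemma zero_in_line [simp]: "0 \<in> line w"
  unfolding line_def by (rule image_eqI[of _ _ 0]) simp_all

lemma line_add: "x \<in> line w \<Longrightarrow> y \<in> line w \<Longrightarrow> x + y \<in> line w"
proof -
  assume "x \<in> line w" "y \<in> line w"
  then obtain i j where "x = i *s w" "y = j *s w"
    unfolding line_def by blast
  then have "x + y = (i + j) *s w"
    by (simp add: vector_sadd_rdistrib)
  then show ?thesis
    unfolding line_def by blast
qed

lemma scal_add:
  assumes "\<And>x y. x \<in> L \<Longrightarrow> y \<in> L \<Longrightarrow> x + y \<in> L" "x \<in> scal k L" "y \<in> scal k L"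
  shows "x + y \<in> scal k L"
proof -
  obtain u v where "x = int k *s u" "u \<in> L" "y = int k *s v" "v \<in> L"
    using assms(2,3) by (auto simp: scal_def)
  then have "x + y = int k *s (u + v)" "u + v \<in> L"
    using assms(1) by (simp_all add: vector_add_ldistrib)
  then show ?thesis
    unfolding scal_def by blast
qed

section \<open>Norms of averages along polynomial paths\<close>

context unitary_action
begin

text \<open>The translation is a whole number of steps of the average, so the difference telescopes
  to boundary terms.\<close>

lemma avg_translate_line:
  fixes j :: int
  assumes "\<gamma> > 0"
  shows "\<forall>\<^sub>F N in sequentially.
    nm (avg N (\<lambda>n. U (int (n * c) *s w) (v - U ((j * int c) *s w) v))) \<le> \<gamma>"
proof -
  have nonneg: "\<forall>\<^sub>F N in sequentially.
      nm (avg N (\<lambda>n. U (int (n * c) *s w) (U ((int i * int c) *s w) v - v))) \<le> \<gamma>" for i v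
  proof -
    have "\<forall>\<^sub>F N in sequentially. 2 * real i * nm v / real N \<le> \<gamma>"
      by (rule eventually_div_le[OF assms])
    then show ?thesis
    proof eventually_elim
      case (elim N)
      let ?x = "\<lambda>n. U (int (n * c) *s w) v"
      have "int ((n + i) * c) *s w = int (n * c) *s w + (int i * int c) *s w" for n
        by (simp add: vec_eq_iff algebra_simps)
      then have "avg N (\<lambda>n. U (int (n * c) *s w) (U ((int i * int c) *s w) v - v))
          = avg N (\<lambda>n. ?x (n + i)) - avg N ?x"
        by (simp add: U_diff avg_diff U_plus del: of_nat_mult)
      moreover have "nm (avg N (\<lambda>n. ?x (n + i)) - avg N ?x) \<le> 2 * real i * nm v / real N"
        by (rule nm_avg_shift) simp
      ultimately show ?case
        using elim by simp
    qed
  qed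
  show ?thesis
  proof (cases "j \<ge> 0")
    case True
    then obtain i where j: "j = int i"
      by (metis zero_le_imp_eq_int)
    have "nm (avg N (\<lambda>n. U (int (n * c) *s w) (v - U ((j * int c) *s w) v)))
        = nm (avg N (\<lambda>n. U (int (n * c) *s w) (U ((int i * int c) *s w) v - v)))" for N
      unfolding j U_diff avg_diff by (rule nm_diff_commute)
    then show ?thesis
      using nonneg by simp
  next
    case False
    then obtain i where j: "j = - int i"
      by (metis int_cases2 of_nat_0_le_iff)
    \<comment> \<open>For negative \<open>j\<close> the roles are exchanged: \<open>v\<close> is the
      translate of \<open>u\<close> by \<open>i\<close> steps forward.\<close>
    define u where "u = U ((j * int c) *s w) v"
    have "U ((int i * int c) *s w) u = U ((int i * int c) *s w + (j * int c) *s w) v"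
      by (simp add: u_def U_plus)
    also have "(int i * int c) *s w + (j * int c) *s w = 0"
      by (simp add: vec_eq_iff j)
    finally have "U ((int i * int c) *s w) u = v"
      by (simp add: U_zero)
    then show ?thesis
      using nonneg[of i u] by (simp add: u_def)
  qed
qed

lemma avg_avop_line:
  assumes "avop (scal c (line w)) T" "\<gamma> > 0"
  shows "\<forall>\<^sub>F N in sequentially. nm (avg N (\<lambda>n. U (int (n * c) *s w) (v - T v))) \<le> \<gamma>"
  using assms(1)
proof (induction rule: avop.induct)
  case (avop_base x)
  then obtain j where "x = (j * int c) *s w"
    by (auto simp: scal_def line_def vector_smult_assoc mult.commute)
  then show ?case
    using avg_translate_line[OF assms(2)] by blast
next
  case (avop_conv S T t)
  from avop_conv.IH show ?case
  proof eventually_elim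
    case (elim N)
    let ?A = "\<lambda>u. avg N (\<lambda>n. U (int (n * c) *s w) u)"
    have "v - ((1 - t) *\<^sub>R S v + t *\<^sub>R T v) = (1 - t) *\<^sub>R (v - S v) + t *\<^sub>R (v - T v)"
      by (simp add: algebra_simps)
    then have "?A (v - ((1 - t) *\<^sub>R S v + t *\<^sub>R T v)) = (1 - t) *\<^sub>R ?A (v - S v) + t *\<^sub>R ?A (v - T v)"
      by (simp add: U_add U_scaleR avg_add avg_scaleR del: of_nat_mult)
    then show ?case
      using nm_convex elim avop_conv by simp
  qed
qed

text \<open>Induction on the degree, splitting \<open>f = f1 + f2\<close> along the direction
  \<open>w\<close> of the leading coefficient. \<open>f1\<close> nearly minimises the energy over
  multiples of \<open>k *s w\<close>, so it is nearly invariant there and hardly feels the leading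
  term; \<open>f2\<close> has small averages along every multiple of \<open>w\<close>, so
  \<open>polynomial_average_small\<close> applies. The quantifier over \<open>K'\<close> lets the
  step be made divisible by \<open>k\<close> after the induction hypothesis has been used.\<close>

lemma polynomial_average_le:
  assumes "nm f \<le> 1" "\<epsilon> > 0"
    and "\<And>k. k \<ge> 1 \<Longrightarrow> \<exists>T. avop (scal k (lattice_span ws J)) T \<and> nm (T f) \<le> \<beta>"
  shows "\<exists>K\<ge>1. \<forall>K'\<ge>1. \<forall>\<^sub>F N in sequentially.
           nm (avg N (\<lambda>n. U (pval ws J (K * K' * n)) f)) \<le> \<beta> + \<epsilon>"
  using assms
proof (induction J arbitrary: f \<beta> \<epsilon>)
  case 0
  obtain T where T: "avop (scal 1 (lattice_span ws 0)) T" "nm (T f) \<le> \<beta>"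
    using "0.prems"(3) by auto
  \<comment> \<open>\<open>lattice_span ws 0\<close> is \<open>{0}\<close>, so every averaging
    operator over it is the identity.\<close>
  have "T v = v" for v
    using T(1)
  proof (induction rule: avop.induct)
    case (avop_base x)
    then show ?case
      by (auto simp: scal_def lattice_span_def U_zero)
  qed (simp add: algebra_simps)
  then have "nm f \<le> \<beta>"
    using T by simp
  then have "nm (avg N (\<lambda>n. U (pval ws 0 (1 * K' * n)) f)) \<le> \<beta> + \<epsilon>" for K' N
    using "0.prems"(2) nm_nonneg[of f] by (intro nm_avg_le) (simp, linarith)
  then show ?case
    by (intro exI[of _ 1]) simp
next
  case (Suc J)
  define w where "w = ws (Suc J)"
  let ?D = "\<lambda>k. scal k (line w)"
  obtain \<delta> where \<delta>: "\<delta> > 0" and small: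
    "\<And>g w ws c. 1 \<le> c \<Longrightarrow> nm g \<le> 2 \<Longrightarrow> ws (Suc J) = int c *s w \<Longrightarrow>
      \<forall>c\<ge>1. \<forall>\<^sub>F N in sequentially. nm (avg N (\<lambda>n. U (int (n * c) *s w) g)) \<le> \<delta> \<Longrightarrow>
      \<forall>\<^sub>F N in sequentially. nm (avg N (\<lambda>n. U (pval ws (Suc J) n) g)) \<le> \<epsilon> / 3"
    using polynomial_average_small[of "\<epsilon> / 3" J] Suc.prems(2) by auto
  \<comment> \<open>\<open>2 * \<sigma> \<le> \<delta>\<close> is for \<open>f2\<close>. In the
    final sum, one \<open>\<sigma>\<close> pays for dropping the leading term and one for raising
    \<open>\<beta>\<close>; with \<open>\<epsilon> / 3\<close> from each part the total stays within
    \<open>\<epsilon>\<close>.\<close>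
  define \<sigma> where "\<sigma> = min (\<delta> / 2) (\<epsilon> / 6)"
  have \<sigma>: "\<sigma> > 0" "2 * \<sigma> \<le> \<delta>" "6 * \<sigma> \<le> \<epsilon>"
    using \<delta> Suc.prems(2) by (auto simp: \<sigma>_def)
  define \<eta> where "\<eta> = \<sigma>\<^sup>2 / 8"
  have \<eta>: "\<eta> > 0"
    using \<sigma> by (simp add: \<eta>_def)
  have sqrt_\<eta>: "2 * sqrt (2 * \<eta>) = \<sigma>"
    using \<sigma>(1) by (simp add: \<eta>_def real_sqrt_divide)
  obtain k where k: "k \<ge> 1" and stable:
    "\<And>k'. k' \<ge> 1 \<Longrightarrow> energy (?D (k * k')) f \<le> energy (?D k) f + \<eta>"
    using energy_stable[of "line w" \<eta> f] \<eta> by auto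
  have zD: "0 \<in> ?D k" for k
    by (simp add: zero_in_scal)
  have D_sub: "?D (k * k') \<subseteq> ?D k" for k k'
    using scal_mult_subset line_smult by blast
  obtain R where R: "avop (?D k) R" "ip (R f) (R f) \<le> energy (?D k) f + \<eta>"
    using energy_near[OF zD \<eta>] by metis
  define f1 where "f1 = R f"
  define f2 where "f2 = f - f1"
  have f1: "nm f1 \<le> 1"
    using avop_nm[OF R(1), of f] Suc.prems(1) by (simp add: f1_def)
  have f2: "nm f2 \<le> 2"
    using nm_triangle_minus[of f f1] f1 Suc.prems(1) by (simp add: f2_def)
  have close: "nm (S f - f1) \<le> \<sigma>"
    if "avop (?D k) S" "ip (S f) (S f) \<le> energy (?D k) f + 2 * \<eta>" for S
    unfolding f1_def sqrt_\<eta>[symmetric] using that R \<eta> by (intro energy_close) auto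
  have shift: "nm (U z f1 - f1) \<le> \<sigma>" if "z \<in> ?D k" for z
  proof -
    have "avop (?D k) (\<lambda>v. U z (R v))"
      using R(1) by (rule avop_shift) (use scal_add line_add that in blast)
    then show ?thesis
      using close[of "\<lambda>v. U z (R v)"] R(2) \<eta> by (simp add: U_ip f1_def)
  qed
  have near: "\<exists>S. avop (?D (k * k')) S \<and> ip (S f) (S f) \<le> energy (?D k) f + 2 * \<eta>" if "k' \<ge> 1" for k'
  proof -
    obtain S where S: "avop (?D (k * k')) S" "ip (S f) (S f) \<le> energy (?D (k * k')) f + \<eta>"
      using energy_near[OF zD \<eta>] by metis
    have "ip (S f) (S f) \<le> energy (?D k) f + 2 * \<eta>"
      using S(2) stable[OF that] by linarith
    with S(1) show ?thesis by blast
  qed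
  have "\<forall>\<^sub>F N in sequentially. nm (avg N (\<lambda>n. U (int (n * c) *s w) f2)) \<le> \<delta>" if c: "c \<ge> 1" for c
  proof -
    obtain S where S: "avop (?D (k * c)) S" "ip (S f) (S f) \<le> energy (?D k) f + 2 * \<eta>"
      using near c by blast
    have "?D (k * c) \<subseteq> ?D c"
      using D_sub[of c k] by (simp add: mult.commute)
    then have "avop (?D c) S"
      using S avop_mono by blast
    then have "\<forall>\<^sub>F N in sequentially. nm (avg N (\<lambda>n. U (int (n * c) *s w) (f - S f))) \<le> \<sigma>"
      using \<sigma>(1) by (rule avg_avop_line)
    then show ?thesis
    proof eventually_elim
      case (elim N)
      have "nm (S f - f1) \<le> \<sigma>"
        using S avop_mono[OF S(1) D_sub] by (intro close)
      then have "nm (avg N (\<lambda>n. U (int (n * c) *s w) (S f - f1))) \<le> \<sigma>"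
        using \<sigma> by (intro nm_avg_le) auto
      moreover have eq: "avg N (\<lambda>n. U (int (n * c) *s w) f2)
          = avg N (\<lambda>n. U (int (n * c) *s w) (f - S f)) + avg N (\<lambda>n. U (int (n * c) *s w) (S f - f1))"
        unfolding f2_def by (simp add: U_diff avg_diff del: of_nat_mult)
      ultimately show ?case
        unfolding eq using elim \<sigma> by (intro order_trans[OF nm_triangle]) linarith
    qed
  qed
  then have part2: "\<forall>\<^sub>F N in sequentially. nm (avg N (\<lambda>n. U (pval ws (Suc J) (K * n)) f2)) \<le> \<epsilon> / 3"
    if "K \<ge> 1" for K
    unfolding pval_scale using f2 that
    by (intro small[where c = "K ^ Suc J" and w = w]) (auto simp: w_def)
  \<comment> \<open>The hypothesis of the induction, for \<open>f1\<close>. All translates of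
    \<open>S f\<close> along the line are close to \<open>f1\<close>, so the
    \<open>w\<close>-components of the translations in \<open>T\<close> can be erased, giving
    \<open>T'\<close> with \<open>T' f1\<close> close to \<open>T (S f)\<close>; and
    \<open>T (S f) = S (T f)\<close> has norm at most \<open>\<beta>\<close> because
    \<open>S\<close> is a contraction.\<close>
  have "\<exists>T. avop (scal k' (lattice_span ws J)) T \<and> nm (T f1) \<le> \<beta> + \<sigma>" if k': "k' \<ge> 1" for k'
  proof -
    obtain T where T: "avop (scal (k * k') (lattice_span ws (Suc J))) T" "nm (T f) \<le> \<beta>"
      using Suc.prems(3)[of "k * k'"] k k' by auto
    obtain S where S: "avop (?D (k * k')) S" "ip (S f) (S f) \<le> energy (?D k) f + 2 * \<eta>"
      using near k' by blast
    have "\<exists>T'. avop (scal (k * k') (lattice_span ws J)) T' \<and> nm (T (S f) - T' f1) \<le> \<sigma>"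
      using T(1)
    proof (induction rule: avop.induct)
      case (avop_base x)
      then obtain c where x: "x = int (k * k') *s (\<Sum>j=1..Suc J. c j *s ws j)"
        by (auto simp: scal_def lattice_span_def)
      define y where "y = int (k * k') *s (\<Sum>j=1..J. c j *s ws j)"
      define z where "z = int (k * k') *s (c (Suc J) *s w)"
      have xyz: "x = y + z"
        by (simp add: x y_def z_def w_def vector_add_ldistrib)
      have y: "y \<in> scal (k * k') (lattice_span ws J)"
        by (auto simp: y_def scal_def lattice_span_def)
      have z: "z \<in> ?D (k * k')"
        unfolding z_def scal_def line_def by (intro imageI rangeI)
      have "avop (?D k) (\<lambda>v. U z (S v))"
        using avop_mono[OF S(1) D_sub] by (rule avop_shift) (use z D_sub scal_add line_add in blast)
      then have "nm (U z (S f) - f1) \<le> \<sigma>"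
        using close[of "\<lambda>v. U z (S v)"] S(2) by (simp add: U_ip)
      then have "nm (U x (S f) - U y f1) \<le> \<sigma>"
        by (simp add: xyz U_plus U_diff[symmetric])
      then show ?case
        using avop.avop_base[OF y] by blast
    next
      case (avop_conv P Q t)
      then obtain P' Q' where P': "avop (scal (k * k') (lattice_span ws J)) P'" "nm (P (S f) - P' f1) \<le> \<sigma>"
        and Q': "avop (scal (k * k') (lattice_span ws J)) Q'" "nm (Q (S f) - Q' f1) \<le> \<sigma>"
        by blast
      have "(1 - t) *\<^sub>R P (S f) + t *\<^sub>R Q (S f) - ((1 - t) *\<^sub>R P' f1 + t *\<^sub>R Q' f1)
          = (1 - t) *\<^sub>R (P (S f) - P' f1) + t *\<^sub>R (Q (S f) - Q' f1)"
        by (simp add: algebra_simps)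
      moreover have "nm \<dots> \<le> \<sigma>"
        using avop_conv P' Q' by (intro nm_convex)
      ultimately show ?case
        using avop.avop_conv[OF P'(1) Q'(1) avop_conv.hyps(3,4)] by auto
    qed
    then obtain T' where T': "avop (scal (k * k') (lattice_span ws J)) T'" "nm (T (S f) - T' f1) \<le> \<sigma>"
      by blast
    have "nm (T (S f)) \<le> \<beta>"
      using avop_commute[OF T(1) S(1), of f] avop_nm[OF S(1), of "T f"] T(2) by simp
    then have "nm (T' f1) \<le> \<beta> + \<sigma>"
      using T'(2) nm_le_add_diff[of "T' f1" "T (S f)"] nm_diff_commute[of "T (S f)" "T' f1"] by simp
    moreover have "scal (k * k') (lattice_span ws J) \<subseteq> scal k' (lattice_span ws J)"
      using scal_mult_subset[OF lattice_span_smult, of ws J k' k] by (simp add: mult.commute)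
    ultimately show ?thesis
      using avop_mono[OF T'(1)] by blast
  qed
  then obtain K where K: "K \<ge> 1" and IH: "\<And>K'. K' \<ge> 1 \<Longrightarrow> \<forall>\<^sub>F N in sequentially.
      nm (avg N (\<lambda>n. U (pval ws J (K * K' * n)) f1)) \<le> (\<beta> + \<sigma>) + \<epsilon> / 3"
    using Suc.IH[OF f1, of "\<epsilon> / 3" "\<beta> + \<sigma>"] Suc.prems(2) by auto
  show ?case
  proof (intro exI[of _ "K * k"] conjI allI impI)
    fix K' :: nat assume K': "K' \<ge> 1"
    let ?M = "K * k * K'"
    have M: "?M \<ge> 1"
      using K k K' by simp
    have "\<forall>\<^sub>F N in sequentially. nm (avg N (\<lambda>n. U (pval ws J (K * (k * K') * n)) f1)) \<le> (\<beta> + \<sigma>) + \<epsilon> / 3"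
      using k K' by (intro IH) simp
    with part2[OF M] show "\<forall>\<^sub>F N in sequentially.
        nm (avg N (\<lambda>n. U (pval ws (Suc J) (?M * n)) f)) \<le> \<beta> + \<epsilon>"
    proof eventually_elim
      case (elim N)
      let ?p = "\<lambda>n. U (pval ws (Suc J) (?M * n))" and ?q = "\<lambda>n. U (pval ws J (?M * n))"
      have "nm (?p n f1 - ?q n f1) \<le> \<sigma>" for n
      proof -
        \<comment> \<open>The factor \<open>k\<close> of \<open>?M\<close> puts the leading term
          into \<open>?D k\<close>, where \<open>f1\<close> is nearly invariant.\<close>
        define z where "z = int ((?M * n) ^ Suc J) *s w"
        have z: "z = int k *s ((int (K * K' * n) * int ((?M * n) ^ J)) *s w)"
          by (simp add: z_def vec_eq_iff ac_simps)
        have "z \<in> ?D k"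
          unfolding z scal_def line_def by (intro imageI rangeI)
        moreover have "pval ws (Suc J) (?M * n) = pval ws J (?M * n) + z"
          by (simp add: pval_def z_def w_def)
        ultimately show ?thesis
          using shift by (simp add: U_plus U_diff[symmetric])
      qed
      then have "nm (avg N (\<lambda>n. ?p n f1 - ?q n f1)) \<le> \<sigma>"
        using \<sigma> by (intro nm_avg_le) auto
      moreover have "avg N (\<lambda>n. ?p n f) = avg N (\<lambda>n. ?p n f1 - ?q n f1) + avg N (\<lambda>n. ?q n f1) + avg N (\<lambda>n. ?p n f2)"
        by (simp add: f2_def U_diff avg_diff)
      ultimately show ?case
        using elim \<sigma> nm_triangle[of "avg N (\<lambda>n. ?p n f1 - ?q n f1) + avg N (\<lambda>n. ?q n f1)" "avg N (\<lambda>n. ?p n f2)"]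
          nm_triangle[of "avg N (\<lambda>n. ?p n f1 - ?q n f1)" "avg N (\<lambda>n. ?q n f1)"]
        by (simp add: mult.assoc)
    qed
  qed (use K k in simp)
qed

end

section \<open>Unipotent powers and full-rank lattices\<close>

definition rvec :: "int^('n::finite) \<Rightarrow> real^'n" where
  "rvec v = (\<chi> i. real_of_int (v $ i))"

lemma rvec_smult: "rvec (c *s x) = real_of_int c *\<^sub>R rvec x"
  by (simp add: rvec_def vec_eq_iff)

lemma rvec_sum: "rvec (sum f A) = (\<Sum>i\<in>A. rvec (f i))"
  by (simp add: rvec_def vec_eq_iff)

lemma rvec_eq_0_iff [simp]: "rvec x = 0 \<longleftrightarrow> x = 0"
  by (simp add: rvec_def vec_eq_iff)

lemma real_mat_rvec: "real_mat A *v rvec x = rvec (A *v x)"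
  by (simp add: rvec_def real_mat_def matrix_vector_mult_def vec_eq_iff)

lemma real_mat_mult: "real_mat (A ** B) = real_mat A ** real_mat B"
  by (simp add: real_mat_def matrix_matrix_mult_def vec_eq_iff)

lemma real_mat_one: "real_mat (mat 1) = mat 1"
  by (simp add: real_mat_def mat_def vec_eq_iff)

lemma matrix_vector_mult_smult: "(A :: int^'m^'n) *v (c *s x) = c *s (A *v x)"
  by (simp add: matrix_vector_mult_def vec_eq_iff sum_distrib_left ac_simps)

lemma matrix_vector_mult_sum: "(A :: int^'m^'n) *v (sum f I) = (\<Sum>i\<in>I. A *v f i)"
  by (induction I rule: infinite_finite_induct) (auto simp: matrix_vector_right_distrib)

lemma matpow_add: "matpow A (m + n) = matpow A m ** matpow A n"
  by (induction m) (simp_all add: matrix_mul_assoc)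

lemma matpow_nilpotent:
  assumes "matpow A N = 0" "N \<le> i"
  shows "matpow A i *v w = 0"
  using matpow_add[of A N "i - N"] assms by simp

text \<open>Binomial expansion of a power of \<open>1 + (s - 1)\<close>, cut off where the powers of
  \<open>s - 1\<close> annihilate \<open>w\<close>; the induction step is Pascal's rule.\<close>

lemma matpow_unipotent:
  fixes s :: "int^'n::finite^'n"
  assumes "matpow (s - mat 1) (Suc r) *v w = 0"
  shows "matpow s n *v w = (\<Sum>i<Suc r. int (n choose i) *s (matpow (s - mat 1) i *v w))"
proof (induction n)
  case 0
  have "(\<Sum>i<r. int (0 choose Suc i) *s (matpow (s - mat 1) (Suc i) *v w)) = 0"
    by (intro sum.neutral) simp
  then show ?case
    by (simp add: sum.lessThan_Suc_shift del: sum.lessThan_Suc matpow.simps(2))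
next
  case (Suc n)
  let ?N = "s - mat 1"
  let ?f = "\<lambda>i. matpow ?N i *v w"
  have step: "?N *v ?f i = ?f (Suc i)" for i
    by (simp add: matrix_vector_mul_assoc)
  have "matpow s (Suc n) *v w = matpow s n *v w + ?N *v (matpow s n *v w)"
    by (simp add: matrix_vector_mul_assoc[symmetric] matrix_vector_mult_diff_rdistrib)
  also have "?N *v (matpow s n *v w) = (\<Sum>i<Suc r. int (n choose i) *s ?f (Suc i))"
    unfolding Suc.IH by (simp only: matrix_vector_mult_sum matrix_vector_mult_smult step)
  also have "\<dots> = (\<Sum>i<r. int (n choose i) *s ?f (Suc i))"
    using assms by simp
  also have "matpow s n *v w = w + (\<Sum>i<r. int (n choose Suc i) *s ?f (Suc i))"
    unfolding Suc.IH by (simp add: sum.lessThan_Suc_shift del: sum.lessThan_Suc matpow.simps(2))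
  also have "w + (\<Sum>i<r. int (n choose Suc i) *s ?f (Suc i)) + (\<Sum>i<r. int (n choose i) *s ?f (Suc i))
      = w + (\<Sum>i<r. int (Suc n choose Suc i) *s ?f (Suc i))"
    by (simp add: sum.distrib vector_sadd_rdistrib add.commute del: matpow.simps(2))
  also have "\<dots> = (\<Sum>i<Suc r. int (Suc n choose i) *s ?f i)"
    by (simp add: sum.lessThan_Suc_shift del: sum.lessThan_Suc matpow.simps(2) binomial_Suc_Suc)
  finally show ?case .
qed

text \<open>The falling factorial \<open>X (X - 1) ... (X - i + 1)\<close>, which is
  \<open>i!\<close> times the binomial polynomial \<open>X choose i\<close>.\<close>

primrec falling :: "nat \<Rightarrow> int poly" where
  "falling 0 = 1"
| "falling (Suc i) = falling i * [:- int i, 1:]"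

lemma poly_falling: "poly (falling i) (int n) = int (fact i * (n choose i))"
proof (induction i)
  case (Suc i)
  have "int (fact i * (n choose i)) * (int n - int i) = int (fact (Suc i) * (n choose Suc i))"
  proof (cases "i \<le> n")
    case True
    have "Suc i * (n choose Suc i) = (n choose i) * (n - i)"
      using binomial_absorb_comp[of n i] by (metis binomial_absorption mult.commute)
    then have "int (fact (Suc i) * (n choose Suc i)) = int (fact i * ((n choose i) * (n - i)))"
      by (metis fact_Suc mult.assoc mult.commute of_nat_id)
    then show ?thesis
      using True by (simp add: of_nat_diff)
  qed (simp add: binomial_eq_0)
  then show ?case
    by (simp add: Suc algebra_simps del: fact_Suc)
qed simp

lemma coeff_falling_0: "i > 0 \<Longrightarrow> coeff (falling i) 0 = 0"
  using poly_falling[of i 0] by (simp add: poly_0_coeff_0)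

lemma degree_falling: "degree (falling i) \<le> i"
proof (induction i)
  case (Suc i)
  then show ?case
    using degree_mult_le[of "falling i" "[:- int i, 1:]"] by simp
qed simp

text \<open>The binomial expansion of a unipotent power has rational coefficients; passing to
  exponents divisible by \<open>D\<close> makes them integral, while \<open>s\<close> itself stays a rational
  combination of the coefficients.\<close>
lemma unipotent_power_polynomial:
  fixes s :: "int^'n::finite^'n"
  assumes "unipotent s"
  shows "\<exists>I\<ge>1. \<exists>D\<ge>1. \<exists>M :: nat \<Rightarrow> int^'n \<Rightarrow> int^'n.
    (\<forall>m w. matpow s (D * m) *v w = (\<Sum>i<I. (int m ^ i) *s M i w)) \<and>
    (\<forall>w. M 0 w = w) \<and>
    (\<forall>w. (int D ^ I) *s (s *v w) = (\<Sum>i<I. (int D ^ (I - i)) *s M i w))"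
proof -
  obtain r where r: "matpow (s - mat 1) r = 0"
    using assms by (auto simp: unipotent_def)
  define I where "I = Suc r"
  define D :: nat where "D = fact I"
  define N where "N i w = matpow (s - mat 1) i *v w" for i w
  \<comment> \<open>The coefficient of \<open>m ^ l\<close> in \<open>(D * m) choose i\<close>. For
    \<open>i < I\<close> the division is exact: \<open>i!\<close> divides \<open>D ^ l\<close> when
    \<open>l > 0\<close> because \<open>D = I!\<close>, and the constant coefficient vanishes unless
    \<open>i = 0\<close>.\<close>
  define c where "c i l = coeff (falling i) l * int D ^ l div fact i" for i l
  define M where "M l w = (\<Sum>i<I. c i l *s N i w)" for l w
  have exact: "fact i * c i l = coeff (falling i) l * int D ^ l" if "i < I" for i l
  proof -
    have "(fact i :: int) dvd coeff (falling i) l * int D ^ l"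
    proof (cases "l = 0")
      case True
      then show ?thesis
        by (cases "i = 0") (auto simp: coeff_falling_0)
    next
      case False
      have "(fact i :: int) dvd fact I"
        using that by (intro fact_dvd) simp
      also have "\<dots> dvd int D ^ l"
        using False by (simp add: D_def dvd_power)
      finally show ?thesis by simp
    qed
    then show ?thesis
      by (simp add: c_def)
  qed
  have poly_sum: "poly (falling i) x = (\<Sum>l<I. coeff (falling i) l * x ^ l)" if "i < I" for i x
  proof -
    have "(\<Sum>l\<le>degree (falling i). coeff (falling i) l * x ^ l) = (\<Sum>l<I. coeff (falling i) l * x ^ l)"
    proof (rule sum.mono_neutral_left)
      show "{..degree (falling i)} \<subseteq> {..<I}"
        using degree_falling[of i] that by auto
    qed (auto simp: coeff_eq_0)
    then show ?thesis
      by (simp add: poly_altdef)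
  qed
  have binom: "int (D * m choose i) = (\<Sum>l<I. int m ^ l * c i l)" if "i < I" for i m
  proof -
    have "fact i * int (D * m choose i) = (\<Sum>l<I. coeff (falling i) l * int (D * m) ^ l)"
      using poly_falling[of i "D * m"] poly_sum[OF that] by simp
    also have "\<dots> = (\<Sum>l<I. fact i * (int m ^ l * c i l))"
      using exact[OF that] by (intro sum.cong refl) (simp add: power_mult_distrib ac_simps)
    finally have "fact i * int (D * m choose i) = fact i * (\<Sum>l<I. int m ^ l * c i l)"
      by (simp add: sum_distrib_left)
    then show ?thesis by simp
  qed
  \<comment> \<open>Formally the evaluation at \<open>m = 1 / D\<close>, where the exponent
    \<open>D * m\<close> is 1, with denominators cleared by \<open>D ^ I\<close>.\<close>
  have one: "int D ^ I * int (1 choose i) = (\<Sum>l<I. int D ^ (I - l) * c i l)" if "i < I" for i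
  proof -
    have "fact i * (int D ^ I * int (1 choose i)) = int D ^ I * (\<Sum>l<I. coeff (falling i) l)"
      using poly_falling[of i 1] poly_sum[OF that, of 1] by simp
    also have "\<dots> = (\<Sum>l<I. fact i * (int D ^ (I - l) * c i l))"
      unfolding sum_distrib_left
    proof (intro sum.cong refl)
      fix l assume "l \<in> {..<I}"
      then have "int D ^ I = int D ^ (I - l) * int D ^ l"
        by (simp add: power_add[symmetric])
      then show "int D ^ I * coeff (falling i) l = fact i * (int D ^ (I - l) * c i l)"
        using exact[OF that, of l] by (simp add: ac_simps)
    qed
    finally have "fact i * (int D ^ I * int (1 choose i)) = fact i * (\<Sum>l<I. int D ^ (I - l) * c i l)"
      by (simp add: sum_distrib_left)
    then show ?thesis by simp
  qed
  have expand: "matpow s n *v w = (\<Sum>i<I. int (n choose i) *s N i w)" for n w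
    unfolding I_def N_def by (rule matpow_unipotent) (rule matpow_nilpotent[OF r], simp)
  have comb: "(\<Sum>i<I. a i *s N i w) = (\<Sum>l<I. b l *s M l w)"
    if "\<And>i. i < I \<Longrightarrow> a i = (\<Sum>l<I. b l * c i l)" for a b w
  proof -
    have "(\<Sum>i<I. a i *s N i w) = (\<Sum>i<I. (\<Sum>l<I. b l * c i l) *s N i w)"
      using that by simp
    also have "\<dots> = (\<Sum>l<I. b l *s M l w)"
      unfolding M_def vec_eq_iff
      by (simp add: sum_distrib_left sum_distrib_right mult.assoc) (intro allI sum.swap)
    finally show ?thesis .
  qed
  have "M 0 w = w" for w
  proof -
    have "c i 0 = (if i = 0 then 1 else 0)" for i
      by (simp add: c_def coeff_falling_0)
    then have "M 0 w = (\<Sum>i<I. if i = 0 then N i w else 0)"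
      unfolding M_def by (intro sum.cong refl) auto
    then show ?thesis
      by (simp add: I_def N_def)
  qed
  moreover have "matpow s (D * m) *v w = (\<Sum>i<I. (int m ^ i) *s M i w)" for m w
    unfolding expand using binom by (rule comb)
  moreover have "(int D ^ I) *s (s *v w) = (\<Sum>i<I. (int D ^ (I - i)) *s M i w)" for w
  proof -
    have "s *v w = matpow s 1 *v w"
      by simp
    then show ?thesis
      using comb[of "\<lambda>i. int D ^ I * int (1 choose i)" "\<lambda>l. int D ^ (I - l)" w, OF one]
      by (simp only: expand) (simp add: vec_eq_iff sum_distrib_left mult.assoc)
  qed
  moreover have "I \<ge> 1"
    by (simp add: I_def)
  moreover have "D \<ge> 1"
    by (simp only: D_def fact_ge_1)
  ultimately show ?thesis by blast
qed

section \<open>Lattices spanned by the coefficients of a path\<close>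

lemma lattice_spanI: "(\<Sum>j=1..J. c j *s ws j) \<in> lattice_span ws J"
  unfolding lattice_span_def by (rule rangeI)

lemma lattice_span_add:
  assumes "x \<in> lattice_span ws J" "y \<in> lattice_span ws J"
  shows "x + y \<in> lattice_span ws J"
proof -
  obtain c d where "x = (\<Sum>j=1..J. c j *s ws j)" "y = (\<Sum>j=1..J. d j *s ws j)"
    using assms unfolding lattice_span_def by blast
  then have "x + y = (\<Sum>j=1..J. (c j + d j) *s ws j)"
    by (simp add: sum.distrib vector_sadd_rdistrib)
  then show ?thesis
    by (simp only: lattice_spanI)
qed

lemma lattice_span_sum:
  assumes "\<And>i. i \<in> A \<Longrightarrow> f i \<in> lattice_span ws J"
  shows "sum f A \<in> lattice_span ws J"
  using assms by (induction A rule: infinite_finite_induct) (auto simp: lattice_span_add)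

lemma lattice_span_base:
  assumes "j \<in> {1..J}"
  shows "ws j \<in> lattice_span ws J"
proof -
  have "(\<Sum>i=1..J. (if i = j then 1 else 0 :: int) *s ws i) = (\<Sum>i=1..J. if i = j then ws i else 0)"
    by (intro sum.cong refl) auto
  also have "\<dots> = ws j"
    using assms by simp
  finally have "ws j = (\<Sum>i=1..J. (if i = j then 1 else 0 :: int) *s ws i)"
    by (rule sym)
  then show ?thesis
    using lattice_spanI[of "\<lambda>i. if i = j then 1 else 0" ws J] by simp
qed

text \<open>By Cramer's rule the determinant of a basis among the generators is a suitable multiplier.\<close>
lemma full_rank_lattice:
  fixes ws :: "nat \<Rightarrow> int^'n::finite"
  assumes "span (rvec ` ws ` {1..J}) = UNIV"
  obtains k :: nat where "k \<ge> 1" "\<And>x. int k *s x \<in> lattice_span ws J"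
proof -
  obtain B where B: "B \<subseteq> rvec ` ws ` {1..J}" "independent B" "span B = UNIV"
    using maximal_independent_subset[of "rvec ` ws ` {1..J}"] assms
    by (metis span_mono span_span subset_antisym top_greatest)
  have "card B = CARD('n)"
    using B dim_eq_card[of B UNIV] by simp
  moreover have "finite B"
    using B by (simp add: independent_imp_finite)
  ultimately obtain f :: "'n \<Rightarrow> real^'n" where f: "bij_betw f UNIV B"
    by (metis finite_same_card_bij finite_class.finite_UNIV)
  have "f i \<in> rvec ` ws ` {1..J}" for i
    using f B(1) bij_betwE by blast
  then have "\<forall>i. \<exists>j. j \<in> {1..J} \<and> f i = rvec (ws j)"
    by blast
  then obtain b where b: "\<And>i. b i \<in> {1..J}" "\<And>i. f i = rvec (ws (b i))"
    by metis
  define A :: "int^'n^'n" where "A = (\<chi> i j. ws (b j) $ i)"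
  have det_real: "det (real_mat C) = real_of_int (det C)" for C :: "int^'n^'n"
    by (simp add: det_def real_mat_def)
  have "columns (real_mat A) = B"
  proof -
    have "column j (real_mat A) = f j" for j
      by (simp add: column_def real_mat_def A_def b rvec_def vec_eq_iff)
    then show ?thesis
      using f by (auto simp: columns_def bij_betw_def)
  qed
  then have "\<exists>C. real_mat A ** C = mat 1"
    using B matrix_right_invertible_span_columns[of "real_mat A"] by (simp add: span_vec_eq)
  then have "det (real_mat A) \<noteq> 0"
    by (simp add: invertible_right_inverse invertible_det_nz[symmetric])
  then have det_nz: "det A \<noteq> 0"
    by (simp add: det_real)
  show ?thesis
  proof
    show "nat \<bar>det A\<bar> \<ge> 1"
      using det_nz by simp
    fix x :: "int^'n"
    define z where "z k = det (\<chi> i j. if j = k then x $ i else A $ i $ j)" for k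
    define y where "y = (\<chi> k. det (\<chi> i j. if j = k then rvec x $ i else real_mat A $ i $ j) / det (real_mat A))"
    have "real_mat A *v y = rvec x"
      using cramer[of "real_mat A" y "rvec x"] det_nz by (simp add: det_real y_def)
    moreover have "det (\<chi> i j. if j = k then rvec x $ i else real_mat A $ i $ j) = real_of_int (z k)" for k
      unfolding z_def det_real[symmetric]
      by (rule arg_cong[where f = det]) (simp add: real_mat_def rvec_def vec_eq_iff)
    ultimately have "real_mat A *v (\<chi> k. real_of_int (z k) / real_of_int (det A)) = rvec x"
      by (simp add: y_def det_real)
    then have "real_of_int (\<Sum>k\<in>UNIV. z k * A $ i $ k) = real_of_int (det A * x $ i)" for i
      using det_nz
      by (simp add: vec_eq_iff matrix_vector_mult_def real_mat_def rvec_def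
          sum_divide_distrib[symmetric] field_simps)
    then have "(\<Sum>k\<in>UNIV. z k *s ws (b k)) = det A *s x"
      by (simp add: vec_eq_iff A_def of_int_eq_iff del: of_int_sum of_int_mult)
    moreover have "(\<Sum>k\<in>UNIV. z k *s ws (b k)) \<in> lattice_span ws J"
      by (intro lattice_span_sum lattice_span_smult lattice_span_base b)
    ultimately have "sgn (det A) *s (det A *s x) \<in> lattice_span ws J"
      using lattice_span_smult by metis
    then show "int (nat \<bar>det A\<bar>) *s x \<in> lattice_span ws J"
      by (simp add: vector_smult_assoc sgn_mult_self_eq abs_sgn mult.commute)
  qed
qed

section \<open>Polynomial paths in orbits\<close>

lemma matrix_inv_mult:
  fixes s :: "int^'n::finite^'n"
  assumes "invertible s"
  shows "s ** matrix_inv s = mat 1" "matrix_inv s ** s = mat 1"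
proof -
  have "\<exists>A'. s ** A' = mat 1 \<and> A' ** s = mat 1"
    using assms by (simp add: invertible_def)
  then have "s ** matrix_inv s = mat 1 \<and> matrix_inv s ** s = mat 1"
    unfolding matrix_inv_def by (rule someI_ex)
  then show "s ** matrix_inv s = mat 1" "matrix_inv s ** s = mat 1"
    by auto
qed

text \<open>An injective linear map of \<open>W\<close> into itself is onto by dimension, so its
  inverse preserves \<open>W\<close>. Thus invariance under the generators gives invariance under
  the group.\<close>

lemma inverse_invariant:
  fixes W :: "(real^'n::finite) set"
  assumes W: "subspace W" and s: "invertible s" and inv: "\<And>w. w \<in> W \<Longrightarrow> real_mat s *v w \<in> W"
    and "w \<in> W"
  shows "real_mat (matrix_inv s) *v w \<in> W"
proof -
  let ?f = "(*v) (real_mat s)"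
  have left: "real_mat (matrix_inv s) *v (real_mat s *v v) = v" for v
    by (simp add: matrix_vector_mul_assoc real_mat_mult[symmetric] matrix_inv_mult[OF s] real_mat_one)
  then have "inj ?f"
    by (metis injI)
  then have "dim (?f ` W) = dim W"
    by (intro dim_image_eq matrix_vector_mul_linear) (metis inj_on_subset subset_UNIV)
  moreover have "subspace (?f ` W)"
    using W by (intro linear_subspace_image matrix_vector_mul_linear)
  ultimately have "?f ` W = W"
    using inv W by (intro subspace_dim_equal) auto
  then obtain v where "v \<in> W" "w = real_mat s *v v"
    using \<open>w \<in> W\<close> by blast
  then show ?thesis
    by (simp add: left)
qed

lemma generated_group_invariant:
  fixes W :: "(real^'n::finite) set"
  assumes W: "subspace W" and inv: "\<And>s. s \<in> S \<Longrightarrow> invertible s"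
    and SW: "\<And>s w. s \<in> S \<Longrightarrow> w \<in> W \<Longrightarrow> real_mat s *v w \<in> W"
    and g: "g \<in> generated_group S" and w: "w \<in> W"
  shows "real_mat g *v w \<in> W"
  using g
proof (induction rule: generated_group.induct)
  case gen_one
  then show ?case
    using w by (simp add: real_mat_one)
next
  case (gen_mult s A)
  then show ?case
    using SW by (simp add: real_mat_mult matrix_vector_mul_assoc[symmetric])
next
  case (gen_inv s A)
  then show ?case
    using inverse_invariant[OF W inv SW] by (simp add: real_mat_mult matrix_vector_mul_assoc[symmetric])
qed

locale unipotent_group =
  fixes \<Gamma> S :: "(int^'n::finite^'n) set"
  assumes dim_ge_2: "CARD('n) \<ge> 2"
    and subgroup: "is_subgroup_GL \<Gamma>"
    and irreducible: "irreducible_action \<Gamma>"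
    and gens_subset: "S \<subseteq> \<Gamma>"
    and gens_unipotent: "\<And>s. s \<in> S \<Longrightarrow> unipotent s"
    and gens_generate: "generated_group S = \<Gamma>"
begin

lemma group_invertible: "g \<in> \<Gamma> \<Longrightarrow> invertible g"
  and group_one: "mat 1 \<in> \<Gamma>"
  and group_mult: "g \<in> \<Gamma> \<Longrightarrow> h \<in> \<Gamma> \<Longrightarrow> g ** h \<in> \<Gamma>"
  using subgroup unfolding is_subgroup_GL_def by blast+

lemma group_matpow: "g \<in> \<Gamma> \<Longrightarrow> matpow g n \<in> \<Gamma>"
  by (induction n) (simp_all add: group_one group_mult)

lemma invariant_subspace:
  assumes W: "subspace W" and SW: "\<And>s w. s \<in> S \<Longrightarrow> w \<in> W \<Longrightarrow> real_mat s *v w \<in> W"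
  shows "W = {0} \<or> W = UNIV"
proof -
  have inv: "invertible s" if "s \<in> S" for s
    using that gens_subset group_invertible by blast
  have "real_mat g *v w \<in> W" if "g \<in> \<Gamma>" "w \<in> W" for g w
    using generated_group_invariant[OF W inv SW] that gens_generate by blast
  then show ?thesis
    using irreducible W unfolding irreducible_action_def by blast
qed

text \<open>If no generator escaped, irreducibility would force \<open>W = {0}\<close>; then every
  generator would fix \<open>w0\<close>, and the line through \<open>w0\<close> would be invariant,
  which is impossible in dimension at least 2. The second alternative is what starts the growth from
  \<open>W = {0}\<close>.\<close>

lemma escaping_generator:
  assumes W: "subspace W" "W \<noteq> UNIV" and w0: "w0 \<noteq> (0 :: int^'n)"
  obtains s where "s \<in> S" "(\<exists>w\<in>W. real_mat s *v w \<notin> W) \<or> rvec (s *v w0 - w0) \<notin> W"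
proof (rule ccontr)
  assume "\<not> thesis"
  with that have SW: "\<And>s w. s \<in> S \<Longrightarrow> w \<in> W \<Longrightarrow> real_mat s *v w \<in> W"
    and fix0: "\<And>s. s \<in> S \<Longrightarrow> rvec (s *v w0 - w0) \<in> W"
    by blast+
  have "W = {0}"
    using invariant_subspace[OF W(1) SW] W(2) by blast
  then have fixed: "s *v w0 = w0" if "s \<in> S" for s
    using fix0[OF that] by simp
  have "span {rvec w0} = {0} \<or> span {rvec w0} = UNIV"
  proof (rule invariant_subspace)
    fix s w assume s: "s \<in> S" and "w \<in> span {rvec w0}"
    then obtain c where "w = c *\<^sub>R rvec w0"
      by (auto simp: span_singleton)
    then have "real_mat s *v w = w"
      using fixed[OF s] by (simp add: matrix_vector_mult_scaleR real_mat_rvec)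
    then show "real_mat s *v w \<in> span {rvec w0}"
      using \<open>w \<in> span {rvec w0}\<close> by simp
  qed simp
  moreover have "rvec w0 \<in> span {rvec w0}"
    by (simp add: span_base)
  moreover have "rvec w0 \<noteq> 0"
    using w0 by simp
  ultimately have full: "span {rvec w0} = UNIV"
    by blast
  have "CARD('n) = dim (span {rvec w0})"
    unfolding full by simp
  also have "\<dots> \<le> card {rvec w0}"
    unfolding dim_span by (rule dim_le_card') simp
  finally show False
    using dim_ge_2 by simp
qed

text \<open>Substituting \<open>D * n ^ K\<close> for the exponent of the new generator, with \<open>K\<close> exceeding the
  degree in \<open>n\<close>, keeps the coefficients of the two-variable polynomial apart.\<close>
lemma extend_walk:
  assumes s: "s \<in> S" and walk: "\<And>n. \<exists>\<gamma>\<in>\<Gamma>. pval ws J n = \<gamma> *v a"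
  shows "\<exists>ws' J'. (\<forall>n. \<exists>\<gamma>\<in>\<Gamma>. pval ws' J' n = \<gamma> *v a) \<and>
    span (rvec ` ws ` {1..J}) \<subseteq> span (rvec ` ws' ` {1..J'}) \<and>
    (\<forall>w\<in>span (rvec ` ws ` {1..J}). real_mat s *v w \<in> span (rvec ` ws' ` {1..J'})) \<and>
    rvec (s *v ws 0 - ws 0) \<in> span (rvec ` ws' ` {1..J'})"
proof -
  obtain D I :: nat and M where I: "I \<ge> 1" and D: "D \<ge> 1"
    and pow: "\<And>m w. matpow s (D * m) *v w = (\<Sum>i<I. (int m ^ i) *s M i w)"
    and M0: "\<And>w. M 0 w = w"
    and gen: "\<And>w. (int D ^ I) *s (s *v w) = (\<Sum>i<I. (int D ^ (I - i)) *s M i w)"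
    using unipotent_power_polynomial[OF gens_unipotent[OF s]] by blast
  define K where "K = Suc J"
  \<comment> \<open>\<open>e div K\<close> and \<open>e mod K\<close> recover \<open>(i, j)\<close>
    from \<open>e = i * K + j\<close>. The value 0 matters at \<open>e = I * K\<close>, an index
    that \<open>pval ws' (I * K)\<close> also sums.\<close>
  define ws' where "ws' e = (if e < I * K then M (e div K) (ws (e mod K)) else 0)" for e
  let ?V = "span (rvec ` ws' ` {1..I * K})"
  have coeff: "ws' (i * K + j) = M i (ws j)" if "i < I" "j < K" for i j
  proof -
    have "i * K + j < Suc i * K"
      using that by simp
    also have "Suc i * K \<le> I * K"
      using that by (intro mult_le_mono1) simp
    finally show ?thesis
      using that by (simp add: ws'_def)
  qed
  have base: "rvec (M i (ws j)) \<in> ?V" if "i < I" "j < K" "i * K + j \<ge> 1" for i j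
  proof (rule span_base)
    have "i * K + j < Suc i * K"
      using that by simp
    also have "Suc i * K \<le> I * K"
      using that by (intro mult_le_mono1) simp
    finally have "i * K + j \<in> {1..I * K}"
      using that by simp
    then show "rvec (M i (ws j)) \<in> rvec ` ws' ` {1..I * K}"
      using coeff[OF that(1,2)] by (metis imageI)
  qed
  have walk': "pval ws' (I * K) n = matpow s (D * n ^ K) *v pval ws J n" for n
  proof -
    have "matpow s (D * n ^ K) *v pval ws J n = (\<Sum>j<K. (int n ^ j) *s (\<Sum>i<I. (int (n ^ K) ^ i) *s M i (ws j)))"
      unfolding pval_def K_def lessThan_Suc_atMost[symmetric] matrix_vector_mult_sum matrix_vector_mult_smult pow ..
    also have "\<dots> = (\<Sum>i<I. \<Sum>j<K. (int n ^ (i * K + j)) *s ws' (i * K + j))"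
    proof -
      have "(\<Sum>j<K. (int n ^ j) *s (\<Sum>i<I. (int (n ^ K) ^ i) *s M i (ws j)))
          = (\<Sum>j<K. \<Sum>i<I. (int n ^ (i * K + j)) *s ws' (i * K + j))"
      proof (intro sum.cong refl)
        fix j assume j: "j \<in> {..<K}"
        have pw: "int n ^ j * int (n ^ K) ^ i = int n ^ (i * K + j)" for i
          by (simp add: power_add power_mult[symmetric] mult.commute)
        have "(int n ^ j) *s (\<Sum>i<I. (int (n ^ K) ^ i) *s M i (ws j))
            = (\<Sum>i<I. (int n ^ j * int (n ^ K) ^ i) *s M i (ws j))"
          by (simp add: vec_eq_iff sum_distrib_left mult.assoc del: of_nat_power)
        also have "\<dots> = (\<Sum>i<I. (int n ^ (i * K + j)) *s ws' (i * K + j))"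
          using j by (simp only: pw) (simp add: coeff)
        finally show "(int n ^ j) *s (\<Sum>i<I. (int (n ^ K) ^ i) *s M i (ws j))
            = (\<Sum>i<I. (int n ^ (i * K + j)) *s ws' (i * K + j))" .
      qed
      then show ?thesis
        by (simp only: sum.swap[of _ "{..<K}"])
    qed
    also have "\<dots> = (\<Sum>i<I. \<Sum>e=i * K..<i * K + K. (int n ^ e) *s ws' e)"
    proof (rule sum.cong[OF refl])
      fix i
      have "(\<Sum>e=0 + i * K..<K + i * K. (int n ^ e) *s ws' e) = (\<Sum>j=0..<K. (int n ^ (j + i * K)) *s ws' (j + i * K))"
        by (rule sum.shift_bounds_nat_ivl)
      then show "(\<Sum>j<K. (int n ^ (i * K + j)) *s ws' (i * K + j)) = (\<Sum>e=i * K..<i * K + K. (int n ^ e) *s ws' e)"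
        by (simp add: add.commute atLeast0LessThan)
    qed
    also have "\<dots> = (\<Sum>e<I * K. (int n ^ e) *s ws' e)"
      by (rule sum.nat_group)
    also have "\<dots> = pval ws' (I * K) n"
      by (simp add: pval_def lessThan_Suc_atMost[symmetric] ws'_def)
    finally show ?thesis by simp
  qed
  \<comment> \<open>The factor \<open>D ^ I\<close> in \<open>gen\<close> can be divided out because
    \<open>?V\<close> is a real subspace.\<close>
  have s_rvec: "rvec (s *v w) \<in> ?V" if "\<And>i. i < I \<Longrightarrow> rvec (M i w) \<in> ?V" for w
  proof -
    have "real_of_int (int D ^ I) *\<^sub>R rvec (s *v w) = (\<Sum>i<I. real_of_int (int D ^ (I - i)) *\<^sub>R rvec (M i w))"
      using gen[of w] by (metis (no_types, lifting) rvec_smult rvec_sum sum.cong)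
    also have "\<dots> \<in> ?V"
      using that by (intro span_sum span_scale) simp
    finally have "(1 / real_of_int (int D ^ I)) *\<^sub>R real_of_int (int D ^ I) *\<^sub>R rvec (s *v w) \<in> ?V"
      by (rule span_scale)
    then show ?thesis
      using D by simp
  qed
  show ?thesis
  proof (intro exI conjI allI ballI)
    show "\<exists>\<gamma>\<in>\<Gamma>. pval ws' (I * K) n = \<gamma> *v a" for n
    proof -
      obtain \<gamma> where \<gamma>: "\<gamma> \<in> \<Gamma>" "pval ws J n = \<gamma> *v a"
        using walk by blast
      have "matpow s (D * n ^ K) ** \<gamma> \<in> \<Gamma>"
        using s gens_subset \<gamma> by (intro group_mult group_matpow) auto
      then show ?thesis
        using \<gamma> walk'[of n] by (metis matrix_vector_mul_assoc)
    qed
    have old: "rvec (ws j) \<in> ?V" if "j \<in> {1..J}" for j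
      using base[of 0 j] that I by (simp add: M0 K_def)
    then show "span (rvec ` ws ` {1..J}) \<subseteq> ?V"
      by (intro span_minimal) auto
    have new: "rvec (s *v ws j) \<in> ?V" if "j \<in> {1..J}" for j
      using that by (intro s_rvec base) (auto simp: K_def)
    show "real_mat s *v w \<in> ?V" if "w \<in> span (rvec ` ws ` {1..J})" for w
      using that
    proof (induction rule: span_induct)
      show "subspace {w. real_mat s *v w \<in> ?V}"
        using linear_subspace_vimage[OF matrix_vector_mul_linear[of "real_mat s"] subspace_span[of "rvec ` ws' ` {1..I * K}"]]
        by (simp add: vimage_def)
    qed (use new in \<open>auto simp: real_mat_rvec\<close>)
    \<comment> \<open>The term \<open>i = 0\<close> of \<open>gen\<close> is the constant
      coefficient \<open>ws 0\<close>, which is not among the generators of \<open>?V\<close>;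
      subtracting it leaves only coefficients of positive exponent.\<close>
    show "rvec (s *v ws 0 - ws 0) \<in> ?V"
    proof -
      obtain I' where I': "I = Suc I'"
        using I by (cases I) auto
      have "(int D ^ I) *s (s *v ws 0) = (int D ^ I) *s ws 0 + (\<Sum>i<I'. (int D ^ (I - Suc i)) *s M (Suc i) (ws 0))"
        unfolding gen unfolding I' by (simp add: sum.lessThan_Suc_shift M0 del: sum.lessThan_Suc power_Suc)
      then have "(int D ^ I) *s (s *v ws 0 - ws 0) = (\<Sum>i<I'. (int D ^ (I - Suc i)) *s M (Suc i) (ws 0))"
        by (simp add: vector_ssub_ldistrib)
      then have "real_of_int (int D ^ I) *\<^sub>R rvec (s *v ws 0 - ws 0)
          = (\<Sum>i<I'. real_of_int (int D ^ (I - Suc i)) *\<^sub>R rvec (M (Suc i) (ws 0)))"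
        by (metis (no_types, lifting) rvec_smult rvec_sum sum.cong)
      also have "\<dots> \<in> ?V"
        by (intro span_sum span_scale base) (auto simp: I' K_def)
      finally have "(1 / real_of_int (int D ^ I)) *\<^sub>R real_of_int (int D ^ I) *\<^sub>R rvec (s *v ws 0 - ws 0) \<in> ?V"
        by (rule span_scale)
      then show ?thesis
        using D by simp
    qed
  qed
qed

text \<open>Starting from the constant path \<open>a\<close>, each extension by an escaping
  generator strictly enlarges the span. The constant coefficient stays nonzero, as
  \<open>escaping_generator\<close> demands, because it is the value at \<open>n = 0\<close> and so
  lies in the orbit of \<open>a\<close>.\<close>

lemma walk_of_dimension:
  assumes a: "a \<noteq> 0"
  shows "t \<le> CARD('n) \<Longrightarrow> \<exists>ws J. (\<forall>n. \<exists>\<gamma>\<in>\<Gamma>. pval ws J n = \<gamma> *v a) \<and> t \<le> dim (rvec ` ws ` {1..J})"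
proof (induction t)
  case 0
  have "pval (\<lambda>_. a) 0 n = mat 1 *v a" for n
    by (simp add: pval_def)
  then show ?case
    using group_one by (metis zero_le)
next
  case (Suc t)
  then obtain ws J where walk: "\<And>n. \<exists>\<gamma>\<in>\<Gamma>. pval ws J n = \<gamma> *v a" and t: "t \<le> dim (rvec ` ws ` {1..J})"
    by auto
  let ?W = "span (rvec ` ws ` {1..J})"
  show ?case
  proof (cases "?W = UNIV")
    case True
    then have "dim (rvec ` ws ` {1..J}) = CARD('n)"
      by (metis dim_span dim_UNIV DIM_cart DIM_real mult.right_neutral)
    then show ?thesis
      using Suc.prems walk by (intro exI[of _ ws] exI[of _ J]) auto
  next
    case False
    obtain \<gamma> where "\<gamma> \<in> \<Gamma>" "pval ws J 0 = \<gamma> *v a"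
      using walk by blast
    moreover have "pval ws J 0 = ws 0"
    proof -
      have "pval ws J 0 = (\<Sum>j\<le>J. if j = 0 then ws j else 0)"
        unfolding pval_def by (intro sum.cong refl) (auto simp: vec_eq_iff)
      then show ?thesis by simp
    qed
    ultimately have "matrix_inv \<gamma> *v ws 0 = a"
      using matrix_inv_mult[OF group_invertible] by (simp add: matrix_vector_mul_assoc)
    then have "ws 0 \<noteq> 0"
      using a by auto
    then obtain s where s: "s \<in> S" "(\<exists>w\<in>?W. real_mat s *v w \<notin> ?W) \<or> rvec (s *v ws 0 - ws 0) \<notin> ?W"
      using escaping_generator[OF subspace_span False] by blast
    obtain ws' J' where walk': "\<And>n. \<exists>\<gamma>\<in>\<Gamma>. pval ws' J' n = \<gamma> *v a"
      and sub: "?W \<subseteq> span (rvec ` ws' ` {1..J'})"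
      and new: "\<And>w. w \<in> ?W \<Longrightarrow> real_mat s *v w \<in> span (rvec ` ws' ` {1..J'})"
        "rvec (s *v ws 0 - ws 0) \<in> span (rvec ` ws' ` {1..J'})"
      using extend_walk[OF s(1) walk] by blast
    have "?W \<noteq> span (rvec ` ws' ` {1..J'})"
      using s(2) new by blast
    then have "dim ?W < dim (span (rvec ` ws' ` {1..J'}))"
      using sub by (intro dim_psubset) (auto simp: span_span)
    then show ?thesis
      using t walk' by (intro exI[of _ ws'] exI[of _ J']) (simp add: dim_span)
  qed
qed

lemma spanning_walk:
  assumes "a \<noteq> 0"
  shows "\<exists>ws J. (\<forall>n. \<exists>\<gamma>\<in>\<Gamma>. pval ws J n = \<gamma> *v a) \<and> span (rvec ` ws ` {1..J}) = UNIV"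
proof -
  obtain ws J where walk: "\<And>n. \<exists>\<gamma>\<in>\<Gamma>. pval ws J n = \<gamma> *v a" and d: "CARD('n) \<le> dim (rvec ` ws ` {1..J})"
    using walk_of_dimension[OF assms order_refl] by blast
  have "span (rvec ` ws ` {1..J}) = UNIV"
    using d dim_subset_UNIV[of "rvec ` ws ` {1..J}"] dim_eq_full[of "rvec ` ws ` {1..J}"] by simp
  with walk show ?thesis
    by blast
qed

end

section \<open>An invariant mean on bounded functions\<close>

text \<open>The integer lattice is discrete, so every bounded function on it is bounded continuous;
  the type of bounded continuous functions thus supplies all bounded functions with vector space
  structure and sup norm.\<close>

lemma open_int_vec: "open (A :: (int^'n::finite) set)"
proof -
  have "open {x}" for x :: "int^'n"
  proof -
    have "{x} = (\<Inter>i. (\<lambda>y. y $ i) -` {x $ i})"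
      by (auto simp: vec_eq_iff)
    moreover have "open (\<Inter>i. (\<lambda>y. y $ i) -` {x $ i})"
      by (intro open_INT ballI open_vimage_vec_nth finite_class.finite_UNIV) (rule open_discrete)
    ultimately show ?thesis by simp
  qed
  then have "open (\<Union>x\<in>A. {x})"
    by (intro open_UN ballI)
  then show ?thesis by simp
qed

lemma continuous_on_int_vec: "continuous_on UNIV (g :: int^'n::finite \<Rightarrow> real)"
  by (simp add: continuous_on_open_vimage open_int_vec)

type_synonym 'n bfun = "(int^'n) \<Rightarrow>\<^sub>C real"

abbreviation ap :: "('n::finite) bfun \<Rightarrow> int^'n \<Rightarrow> real" where
  "ap \<equiv> apply_bcontfun"

text \<open>The value is meaningful only for bounded \<open>g\<close>, hence the recurring side
  condition \<open>bdd_fun\<close>.\<close>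

definition bfun :: "(int^'n::finite \<Rightarrow> real) \<Rightarrow> 'n bfun" where
  "bfun g = Bcontfun g"

definition bdd_fun :: "('a \<Rightarrow> real) \<Rightarrow> bool" where
  "bdd_fun g \<longleftrightarrow> (\<exists>b. \<forall>y. \<bar>g y\<bar> \<le> b)"

lemma ap_bfun [simp]:
  assumes "bdd_fun g"
  shows "ap (bfun g) = g"
proof -
  obtain b where "\<And>y. \<bar>g y\<bar> \<le> b"
    using assms unfolding bdd_fun_def by blast
  then have "g \<in> bcontfun"
    by (intro bcontfun_normI[OF continuous_on_int_vec]) simp
  then show ?thesis
    unfolding bfun_def by (rule Bcontfun_inverse)
qed

lemma bdd_fun_ap [simp]: "bdd_fun (ap g)"
  unfolding bdd_fun_def using norm_bounded[of g] by (intro exI[of _ "norm g"]) simp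

lemma bdd_fun_01: "(\<And>y. 0 \<le> g y \<and> g y \<le> 1) \<Longrightarrow> bdd_fun g"
  unfolding bdd_fun_def by (intro exI[of _ 1]) auto

lemma bdd_fun_mult [simp]:
  assumes "bdd_fun g" "bdd_fun h"
  shows "bdd_fun (\<lambda>y. g y * h y)"
proof -
  obtain b c where "\<And>y. \<bar>g y\<bar> \<le> b" "\<And>y. \<bar>h y\<bar> \<le> c"
    using assms unfolding bdd_fun_def by blast
  then have "\<bar>g y * h y\<bar> \<le> b * c" for y
    unfolding abs_mult using abs_ge_zero order_trans by (intro mult_mono) blast+
  then show ?thesis
    unfolding bdd_fun_def by blast
qed

lemma bdd_fun_shift [simp]: "bdd_fun g \<Longrightarrow> bdd_fun (\<lambda>y. g (y + z))"
  unfolding bdd_fun_def by blast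

lemma bdd_fun_const [simp]: "bdd_fun (\<lambda>y. c)"
  unfolding bdd_fun_def by blast

lemma bfun_ap [simp]: "bfun (ap g) = g"
  by (simp add: bfun_def apply_bcontfun_inverse)

section \<open>Cubes and their overlap with translates\<close>

definition box_lu :: "int^'n::finite \<Rightarrow> int^'n \<Rightarrow> (int^'n) set" where
  "box_lu l u = {y. \<forall>i. l $ i \<le> y $ i \<and> y $ i < u $ i}"

lemma
  shows finite_box_lu: "finite (box_lu l u)"
    and card_box_lu: "card (box_lu l u) = (\<Prod>i\<in>UNIV. nat (u $ i - l $ i))"
proof -
  let ?P = "PiE UNIV (\<lambda>i. {l $ i..<u $ i})"
  have eq: "box_lu l u = vec_lambda ` ?P"
  proof (intro set_eqI iffI)
    fix y assume "y \<in> box_lu l u"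
    then have "vec_nth y \<in> ?P"
      by (auto simp: box_lu_def)
    then show "y \<in> vec_lambda ` ?P"
      by (metis image_eqI vec_nth_inverse)
  qed (auto simp: box_lu_def PiE_iff)
  have inj: "inj_on vec_lambda ?P"
    by (auto simp: inj_on_def vec_lambda_inject)
  show "finite (box_lu l u)"
    unfolding eq by (intro finite_imageI finite_PiE) auto
  show "card (box_lu l u) = (\<Prod>i\<in>UNIV. nat (u $ i - l $ i))"
    unfolding eq by (simp add: card_image[OF inj] card_PiE)
qed

lemma cube_eq_box: "cube x R = box_lu x (x + (\<chi> i. int R))"
  by (simp add: cube_def box_lu_def)

lemma finite_cube [simp]: "finite (cube x R)"
  by (simp add: cube_eq_box finite_box_lu)

lemma card_cube: "card (cube (x :: int^'n::finite) R) = R ^ CARD('n)"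
  by (simp add: cube_eq_box card_box_lu)

lemma card_cube_overlap:
  "card (cube x R \<inter> cube (x + z) R) = (\<Prod>i\<in>UNIV. nat (int R - \<bar>z $ i\<bar>))"
proof -
  have "cube x R \<inter> cube (x + z) R
      = box_lu (\<chi> i. max (x $ i) (x $ i + z $ i)) (\<chi> i. min (x $ i) (x $ i + z $ i) + int R)"
    by (auto simp: cube_def box_lu_def min_add_distrib_left)
  then have "card (cube x R \<inter> cube (x + z) R)
      = (\<Prod>i\<in>UNIV. nat (min (x $ i) (x $ i + z $ i) + int R - max (x $ i) (x $ i + z $ i)))"
    by (simp add: card_box_lu)
  also have "\<dots> = (\<Prod>i\<in>UNIV. nat (int R - \<bar>z $ i\<bar>))"
    by (intro prod.cong refl arg_cong[where f = nat]) (auto simp: min_def max_def)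
  finally show ?thesis .
qed

definition cube_mean :: "int^'n::finite \<Rightarrow> nat \<Rightarrow> 'n bfun \<Rightarrow> real" where
  "cube_mean x R g = (\<Sum>y\<in>cube x R. ap g y) / real R ^ CARD('n)"

definition shift :: "int^'n::finite \<Rightarrow> 'n bfun \<Rightarrow> 'n bfun" where
  "shift z g = bfun (\<lambda>y. ap g (y + z))"

lemma ap_shift [simp]: "ap (shift z g) y = ap g (y + z)"
  by (simp add: shift_def)

lemma sum_cube_shift: "(\<Sum>y\<in>cube x R. g (y + z)) = (\<Sum>y\<in>cube (x + z) R. g y)"
proof (rule sum.reindex_bij_witness[of _ "\<lambda>y. y - z" "\<lambda>y. y + z"])
  fix y assume "y \<in> cube x R"
  then have "x $ i \<le> y $ i \<and> y $ i < x $ i + int R" for i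
    by (simp add: cube_def)
  then show "y + z \<in> cube (x + z) R"
    by (simp add: cube_def algebra_simps)
next
  fix y assume "y \<in> cube (x + z) R"
  then have "x $ i + z $ i \<le> y $ i \<and> y $ i < x $ i + z $ i + int R" for i
    by (simp add: cube_def)
  then show "y - z \<in> cube x R"
    by (simp add: cube_def algebra_simps)
qed auto

text \<open>Only the two differences between the cube and its translate contribute, and by
  \<open>overlap_ratio_tendsto\<close> their share of the cube tends to 0 as the side grows.\<close>

lemma cube_mean_shift:
  fixes g :: "'n::finite bfun"
  assumes "R > 0"
  shows "\<bar>cube_mean x R (shift z g) - cube_mean x R g\<bar>
    \<le> 2 * norm g * (1 - (\<Prod>i\<in>UNIV. real (nat (int R - \<bar>z $ i\<bar>)) / real R))"
proof -
  let ?C = "cube x R" and ?C' = "cube (x + z) R"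
  have *: "\<bar>\<Sum>y\<in>A - A'. ap g y\<bar> \<le> norm g * (real R ^ CARD('n) - card (?C \<inter> ?C'))"
    if "(A = ?C \<and> A' = ?C') \<or> (A = ?C' \<and> A' = ?C)" for A A'
  proof -
    have "\<bar>\<Sum>y\<in>A - A'. ap g y\<bar> \<le> (\<Sum>y\<in>A - A'. norm g)"
      using norm_bounded[of g] by (intro order_trans[OF sum_abs] sum_mono) simp
    also have "\<dots> = norm g * real (card (A - A'))"
      by simp
    also have "card (A - A') = card A - card (?C \<inter> ?C')"
      using that by (auto simp: card_Diff_subset_Int Int_commute)
    also have "card A = R ^ CARD('n)"
      using that card_cube by blast
    also have "real (R ^ CARD('n) - card (?C \<inter> ?C')) = real R ^ CARD('n) - card (?C \<inter> ?C')"
      using card_mono[of ?C "?C \<inter> ?C'"] by (simp add: of_nat_diff card_cube)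
    finally show ?thesis .
  qed
  have "(\<Sum>y\<in>?C'. ap g y) = (\<Sum>y\<in>?C' - ?C. ap g y) + (\<Sum>y\<in>?C \<inter> ?C'. ap g y)"
    using sum.Int_Diff[of ?C' "ap g" ?C] by (simp add: Int_commute)
  moreover have "(\<Sum>y\<in>?C. ap g y) = (\<Sum>y\<in>?C - ?C'. ap g y) + (\<Sum>y\<in>?C \<inter> ?C'. ap g y)"
    using sum.Int_Diff[of ?C "ap g" ?C'] by simp
  ultimately have "\<bar>(\<Sum>y\<in>?C'. ap g y) - (\<Sum>y\<in>?C. ap g y)\<bar>
      \<le> 2 * (norm g * (real R ^ CARD('n) - card (?C \<inter> ?C')))"
    using *[of ?C ?C', OF disjI1[OF conjI[OF refl refl]]] *[of ?C' ?C, OF disjI2[OF conjI[OF refl refl]]]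
    by linarith
  then have "\<bar>(\<Sum>y\<in>?C'. ap g y) - (\<Sum>y\<in>?C. ap g y)\<bar> / real R ^ CARD('n)
      \<le> 2 * (norm g * (real R ^ CARD('n) - card (?C \<inter> ?C'))) / real R ^ CARD('n)"
    by (intro divide_right_mono) auto
  also have "\<dots> = 2 * norm g * (1 - (\<Prod>i\<in>UNIV. real (nat (int R - \<bar>z $ i\<bar>)) / real R))"
    using assms by (simp add: card_cube_overlap prod_dividef) (simp add: field_simps)
  finally show ?thesis
    by (simp add: cube_mean_def sum_cube_shift[of "ap g"] diff_divide_distrib[symmetric] abs_divide)
qed

lemma overlap_ratio_tendsto:
  "(\<lambda>R. \<Prod>i\<in>UNIV. real (nat (int R - \<bar>(z :: int^'n::finite) $ i\<bar>)) / real R) \<longlonglongrightarrow> 1"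
proof -
  have "(\<lambda>R. real (nat (int R - \<bar>z $ i\<bar>)) / real R) \<longlonglongrightarrow> 1" for i
  proof (rule Lim_transform_eventually)
    have "(\<lambda>R. 1 - real_of_int \<bar>z $ i\<bar> / real R) \<longlonglongrightarrow> 1 - 0"
      by (intro tendsto_diff tendsto_const lim_const_over_n)
    then show "(\<lambda>R. 1 - real_of_int \<bar>z $ i\<bar> / real R) \<longlonglongrightarrow> 1"
      by simp
    have "\<forall>\<^sub>F R in sequentially. R > nat \<bar>z $ i\<bar>"
      by (rule eventually_gt_at_top)
    then show "\<forall>\<^sub>F R in sequentially. 1 - real_of_int \<bar>z $ i\<bar> / real R = real (nat (int R - \<bar>z $ i\<bar>)) / real R"
    proof eventually_elim
      case (elim R)
      then have "real (nat (int R - \<bar>z $ i\<bar>)) = real R - real_of_int \<bar>z $ i\<bar>"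
        by (simp add: of_nat_nat)
      then show ?case
        using elim by (simp add: diff_divide_distrib)
    qed
  qed
  then have "(\<lambda>R. \<Prod>i\<in>UNIV. real (nat (int R - \<bar>z $ i\<bar>)) / real R) \<longlonglongrightarrow> (\<Prod>i\<in>(UNIV :: 'n set). 1)"
    by (intro tendsto_prod)
  then show ?thesis by simp
qed

lemma dense_cubes:
  fixes B :: "(int^'n::finite) set"
  assumes "upper_banach_density B > 0"
  shows "\<exists>\<delta>>0. \<forall>N. \<exists>R>N. \<exists>x. \<delta> \<le> real (card (B \<inter> cube x R)) / real R ^ CARD('n)"
proof -
  let ?d = "\<lambda>R x. real (card (B \<inter> cube x R)) / real R ^ CARD('n)"
  obtain \<delta> where \<delta>: "0 < ereal \<delta>" "ereal \<delta> < upper_banach_density B"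
    using ereal_dense2[OF assms] by blast
  have "\<exists>R>N. \<exists>x. \<delta> \<le> ?d R x" for N
  proof (rule ccontr)
    assume "\<not> ?thesis"
    then have less: "?d R x < \<delta>" if "R > N" for R x
      using that by (metis linorder_not_less)
    have sup_le: "(SUP x. ereal (?d R x)) \<le> ereal \<delta>" if "R > N" for R
      using less[OF that] by (intro SUP_least) (simp add: less_imp_le)
    have "\<forall>\<^sub>F R in sequentially. (SUP x. ereal (?d R x)) \<le> ereal \<delta>"
      by (rule eventually_mono[OF eventually_gt_at_top[of N]]) (rule sup_le)
    then have "upper_banach_density B \<le> ereal \<delta>"
      unfolding upper_banach_density_def by (rule Limsup_bounded)
    then show False
      using \<delta> by simp
  qed
  then show ?thesis
    using \<delta>(1) by (intro exI[of _ \<delta>]) simp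
qed

locale invariant_mean =
  fixes M :: "'n::finite bfun \<Rightarrow> real"
  assumes M_add: "M (g + h) = M g + M h"
    and M_scaleR: "M (c *\<^sub>R g) = c * M g"
    and M_nonneg: "(\<And>y. 0 \<le> ap g y) \<Longrightarrow> 0 \<le> M g"
    and M_one: "M (bfun (\<lambda>_. 1)) = 1"
    and M_shift: "M (shift z g) = M g"

text \<open>The cube averages lie in a product of compact intervals, so they have a cluster point.
  Each axiom, and the lower bound on \<open>B\<close>, is a closed condition on finitely many
  coordinates and passes to it. There are uncountably many coordinates, so a cluster point of a
  filter is used instead of a convergent subsequence.\<close>

lemma exists_invariant_mean:
  fixes B :: "(int^'n::finite) set"
  assumes "upper_banach_density B > 0"
  shows "\<exists>M. invariant_mean M \<and> 0 < M (bfun (\<lambda>y. if y \<in> B then 1 else 0))"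
proof -
  let ?ind = "bfun (\<lambda>y. if y \<in> B then 1 else 0)"
  have ind: "ap ?ind = (\<lambda>y. if y \<in> B then 1 else 0)"
    by (intro ap_bfun bdd_fun_01) auto
  obtain \<delta> R x where \<delta>: "\<delta> > 0" and R: "\<And>N. R N > N"
    and dens: "\<And>N. \<delta> \<le> real (card (B \<inter> cube (x N) (R N))) / real (R N) ^ CARD('n)"
    using dense_cubes[OF assms] by metis
  have R_pos: "R N > 0" for N
    using R[of N] by simp
  define \<phi> where "\<phi> N = cube_mean (x N) (R N)" for N
  define K where "K = PiE UNIV (\<lambda>g :: 'n bfun. cball (0 :: real) (norm g))"
  have "compactin (product_topology (\<lambda>_. euclidean) UNIV) K"
    unfolding K_def by (simp add: compactin_PiE)
  then have "compact K"
    by (simp only: euclidean_product_topology compactin_euclidean_iff)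
  moreover have "\<phi> N \<in> K" for N
  proof -
    have "\<bar>\<phi> N g\<bar> \<le> norm g" for g
    proof -
      have "\<bar>\<Sum>y\<in>cube (x N) (R N). ap g y\<bar> \<le> (\<Sum>y\<in>cube (x N) (R N). norm g)"
        using norm_bounded[of g] by (intro order_trans[OF sum_abs] sum_mono) simp
      also have "\<dots> = real (R N) ^ CARD('n) * norm g"
        by (simp add: card_cube)
      finally show ?thesis
        using R_pos[of N] by (simp add: \<phi>_def cube_mean_def field_simps)
    qed
    then show ?thesis
      by (auto simp: K_def)
  qed
  ultimately obtain M where M: "inf (nhds M) (filtermap \<phi> sequentially) \<noteq> bot"
    unfolding compact_filter using filtermap_bot_iff[of \<phi> sequentially]
    by (metis (no_types, lifting) always_eventually eventually_filtermap sequentially_bot)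
  have limit: "M \<in> C" if "closed C" "\<forall>\<^sub>F N in sequentially. \<phi> N \<in> C" for C
  proof (rule ccontr)
    assume "M \<notin> C"
    then have "eventually (\<lambda>\<psi>. \<psi> \<in> - C) (nhds M)"
      using that(1) by (intro eventually_nhds_in_open) auto
    moreover have "eventually (\<lambda>\<psi>. \<psi> \<in> C) (filtermap \<phi> sequentially)"
      using that(2) by (simp add: eventually_filtermap)
    ultimately have "eventually (\<lambda>_. False) (inf (nhds M) (filtermap \<phi> sequentially))"
      unfolding eventually_inf by blast
    with M show False
      by (simp add: trivial_limit_def)
  qed
  \<comment> \<open>Three coordinates are enough for every axiom; equalities are coded as an
    absolute value \<open>\<le> 0\<close>.\<close>
  have closed_le: "closed {\<psi> :: 'n bfun \<Rightarrow> real. a (\<psi> g) (\<psi> h) (\<psi> k) \<le> (c :: real)}"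
    if "continuous_on UNIV (\<lambda>(p, q, r). a p q r)" for a g h k c
  proof (rule closed_Collect_le)
    have "continuous_on UNIV (\<lambda>\<psi> :: 'n bfun \<Rightarrow> real. (\<psi> g, \<psi> h, \<psi> k))"
      by (intro continuous_on_Pair continuous_on_product_coordinates)
    from continuous_on_compose2[OF that this]
    show "continuous_on UNIV (\<lambda>\<psi> :: 'n bfun \<Rightarrow> real. a (\<psi> g) (\<psi> h) (\<psi> k))"
      by simp
  qed (rule continuous_on_const)
  have "invariant_mean M"
  proof
    fix g h
    have "M \<in> {\<psi>. \<bar>\<psi> (g + h) - \<psi> g - \<psi> h\<bar> \<le> 0}"
      by (intro limit closed_le always_eventually)
        (auto simp: \<phi>_def cube_mean_def sum.distrib add_divide_distrib case_prod_beta
          intro!: continuous_intros)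
    then show "M (g + h) = M g + M h"
      by simp
  next
    fix c g
    have "M \<in> {\<psi>. \<bar>\<psi> (c *\<^sub>R g) - c * \<psi> g\<bar> \<le> 0}"
      by (intro limit closed_le[of "\<lambda>p q r. \<bar>p - c * q\<bar>" _ _ g] always_eventually)
        (auto simp: \<phi>_def cube_mean_def sum_distrib_left case_prod_beta intro!: continuous_intros)
    then show "M (c *\<^sub>R g) = c * M g"
      by simp
  next
    fix g :: "'n bfun"
    assume "\<And>y. 0 \<le> ap g y"
    then have "M \<in> {\<psi>. - \<psi> g \<le> 0}"
      by (intro limit closed_le[of "\<lambda>p q r. - p" _ g g] always_eventually)
        (auto simp: \<phi>_def cube_mean_def case_prod_beta intro!: continuous_intros sum_nonneg divide_nonneg_nonneg)
    then show "0 \<le> M g"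
      by simp
  next
    have "M \<in> {\<psi>. \<bar>\<psi> (bfun (\<lambda>_. 1)) - 1\<bar> \<le> 0}"
      using R_pos
      by (intro limit closed_le[of "\<lambda>p q r. \<bar>p - 1\<bar>" _ "bfun (\<lambda>_. 1)" "bfun (\<lambda>_. 1)"] always_eventually)
        (auto simp: \<phi>_def cube_mean_def card_cube case_prod_beta intro!: continuous_intros)
    then show "M (bfun (\<lambda>_. 1)) = 1"
      by simp
  next
    fix z g
    \<comment> \<open>Cube averages are invariant only asymptotically, so this closed condition
      carries an \<open>\<epsilon>\<close>.\<close>
    have "\<bar>M (shift z g) - M g\<bar> \<le> \<epsilon>" if "\<epsilon> > 0" for \<epsilon>
    proof -
      have "filterlim R sequentially sequentially"
        using R by (intro filterlim_at_top_mono[OF filterlim_ident]) (simp add: less_imp_le)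
      then have "(\<lambda>N. \<Prod>i\<in>UNIV. real (nat (int (R N) - \<bar>z $ i\<bar>)) / real (R N)) \<longlonglongrightarrow> 1"
        by (rule filterlim_compose[OF overlap_ratio_tendsto])
      then have "(\<lambda>N. 2 * norm g * (1 - (\<Prod>i\<in>UNIV. real (nat (int (R N) - \<bar>z $ i\<bar>)) / real (R N)))) \<longlonglongrightarrow> 2 * norm g * (1 - 1)"
        by (intro tendsto_intros)
      then have "\<forall>\<^sub>F N in sequentially. 2 * norm g * (1 - (\<Prod>i\<in>UNIV. real (nat (int (R N) - \<bar>z $ i\<bar>)) / real (R N))) < \<epsilon>"
        using that by (intro order_tendstoD) auto
      then have "\<forall>\<^sub>F N in sequentially. \<bar>\<phi> N (shift z g) - \<phi> N g\<bar> \<le> \<epsilon>"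
      proof eventually_elim
        case (elim N)
        then show ?case
          using cube_mean_shift[OF R_pos, of "x N" N z g] unfolding \<phi>_def by linarith
      qed
      then have "M \<in> {\<psi>. \<bar>\<psi> (shift z g) - \<psi> g\<bar> \<le> \<epsilon>}"
        by (intro limit closed_le[of "\<lambda>p q r. \<bar>p - q\<bar>" _ _ g])
          (auto simp: case_prod_beta intro!: continuous_intros)
      then show ?thesis by simp
    qed
    then have "\<bar>M (shift z g) - M g\<bar> \<le> 0"
      by (rule field_le_epsilon) simp
    then show "M (shift z g) = M g"
      by simp
  qed
  moreover have "\<delta> \<le> M ?ind"
  proof -
    have "\<phi> N ?ind = real (card (B \<inter> cube (x N) (R N))) / real (R N) ^ CARD('n)" for N
      by (simp add: \<phi>_def cube_mean_def ind sum.If_cases Int_commute)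
    then have "\<forall>\<^sub>F N in sequentially. \<phi> N \<in> {\<psi>. - \<psi> ?ind \<le> - \<delta>}"
      using dens by simp
    then have "M \<in> {\<psi>. - \<psi> ?ind \<le> - \<delta>}"
      by (intro limit closed_le[of "\<lambda>p q r. - p" _ ?ind ?ind])
        (auto simp: case_prod_beta intro!: continuous_intros)
    then show ?thesis by simp
  qed
  ultimately show ?thesis
    using \<delta> by (intro exI[of _ M]) simp
qed

section \<open>Multiple recurrence\<close>

context unitary_action
begin

text \<open>A linear functional on a convex combination is bounded by its bound on the terms. In
  contrapositive form this extracts a single translate from an average.\<close>

lemma avop_ip_le:
  assumes "avop D T" "\<And>x. x \<in> D \<Longrightarrow> ip h (U x f) \<le> c"
  shows "ip h (T f) \<le> c"
  using assms
proof (induction rule: avop.induct)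
  case (avop_conv S T t)
  have "ip h ((1 - t) *\<^sub>R S f + t *\<^sub>R T f) = (1 - t) * ip h (S f) + t * ip h (T f)"
    by (simp add: ip_simps)
  also have "\<dots> \<le> (1 - t) * c + t * c"
    using avop_conv by (intro add_mono mult_left_mono) auto
  finally show ?case
    by (simp add: algebra_simps)
qed

end

definition unit_valued :: "('a \<Rightarrow> real) \<Rightarrow> bool" where
  "unit_valued g \<longleftrightarrow> (\<forall>y. 0 \<le> g y \<and> g y \<le> 1)"

lemma unit_valued_bdd: "unit_valued g \<Longrightarrow> bdd_fun g"
  unfolding unit_valued_def by (rule bdd_fun_01) blast

lemma unit_valued_mult: "unit_valued g \<Longrightarrow> unit_valued h \<Longrightarrow> unit_valued (\<lambda>y. g y * h y)"
  unfolding unit_valued_def by (simp add: mult_le_one)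

lemma unit_valued_power: "unit_valued g \<Longrightarrow> unit_valued (\<lambda>y. g y ^ n)"
  unfolding unit_valued_def by (simp add: power_le_one)

lemma unit_valued_prod:
  assumes "\<And>i. i \<in> I \<Longrightarrow> unit_valued (G i)"
  shows "unit_valued (\<lambda>y. \<Prod>i\<in>I. G i y)"
  using assms unfolding unit_valued_def by (simp add: prod_nonneg prod_le_1)

section \<open>Means of products of functions with values in the unit interval\<close>

context invariant_mean
begin

definition mean :: "(int^'n \<Rightarrow> real) \<Rightarrow> real" where
  "mean g = M (bfun g)"

definition corr :: "'n bfun \<Rightarrow> 'n bfun \<Rightarrow> real" where
  "corr g h = mean (\<lambda>y. ap g y * ap h y)"

lemma M_eq_mean: "M g = mean (ap g)"
  by (simp add: mean_def)

lemma mean_add: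
  assumes "bdd_fun g" "bdd_fun h"
  shows "mean (\<lambda>y. g y + h y) = mean g + mean h"
proof -
  have "(\<lambda>y. g y + h y) = ap (bfun g + bfun h)"
    using assms by simp
  then have "bfun (\<lambda>y. g y + h y) = bfun g + bfun h"
    by (simp only: bfun_ap)
  then show ?thesis
    by (simp only: mean_def M_add)
qed

lemma mean_scale:
  assumes "bdd_fun g"
  shows "mean (\<lambda>y. c * g y) = c * mean g"
proof -
  have "(\<lambda>y. c * g y) = ap (c *\<^sub>R bfun g)"
    using assms by simp
  then have "bfun (\<lambda>y. c * g y) = c *\<^sub>R bfun g"
    by (simp only: bfun_ap)
  then show ?thesis
    by (simp only: mean_def M_scaleR)
qed

lemma mean_const: "mean (\<lambda>_. c) = c"
  using mean_scale[of "\<lambda>_. 1" c] M_one by (simp add: mean_def)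

lemma mean_mono:
  assumes "bdd_fun g" "bdd_fun h" "\<And>y. g y \<le> h y"
  shows "mean g \<le> mean h"
proof -
  have "0 \<le> M (bfun h + (-1) *\<^sub>R bfun g)"
    by (rule M_nonneg) (use assms in simp)
  then show ?thesis
    by (simp only: M_add M_scaleR mean_def)
qed

lemma mean_shift:
  assumes "bdd_fun g"
  shows "mean (\<lambda>y. g (y + z)) = mean g"
  using M_shift[of z "bfun g"] assms by (simp add: mean_def shift_def)

sublocale unitary_action corr shift
proof
  show "corr (x + y) z = corr x z + corr y z" for x y z
    unfolding corr_def by (subst mean_add[symmetric]) (simp_all add: distrib_right)
  show "corr (c *\<^sub>R x) z = c * corr x z" for c x z
    unfolding corr_def by (subst mean_scale[symmetric]) (simp_all add: mult.assoc)
  show "corr x y = corr y x" for x y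
    by (simp add: corr_def mult.commute)
  show "0 \<le> corr x x" for x
    unfolding corr_def using mean_mono[of "\<lambda>_. 0" "\<lambda>y. ap x y * ap x y"] mean_const[of 0] by simp
  show "corr (shift x v) (shift x w) = corr v w" for x v w
    unfolding corr_def using mean_shift[of "\<lambda>y. ap v y * ap w y" x] by simp
qed (auto intro!: bcontfun_eqI simp: add.assoc)

lemma avop_unit_valued:
  assumes "avop D T" "unit_valued (ap f)"
  shows "unit_valued (ap (T f))"
  using assms
proof (induction rule: avop.induct)
  case (avop_conv S T t)
  have "0 \<le> (1 - t) * ap (S f) y + t * ap (T f) y \<and> (1 - t) * ap (S f) y + t * ap (T f) y \<le> 1" for y
  proof
    show "0 \<le> (1 - t) * ap (S f) y + t * ap (T f) y"
      using avop_conv unfolding unit_valued_def by simp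
    have "(1 - t) * ap (S f) y + t * ap (T f) y \<le> (1 - t) * 1 + t * 1"
      using avop_conv unfolding unit_valued_def by (intro add_mono mult_left_mono) auto
    then show "(1 - t) * ap (S f) y + t * ap (T f) y \<le> 1"
      by simp
  qed
  then show ?case
    unfolding unit_valued_def by simp
qed (simp add: unit_valued_def)

lemma avop_M: "avop D T \<Longrightarrow> M (T f) = M f"
  by (induction rule: avop.induct) (simp_all add: M_shift M_add M_scaleR left_diff_distrib)

lemma nm_le_one:
  assumes "unit_valued (ap f)"
  shows "nm f \<le> 1"
proof -
  have "unit_valued (\<lambda>y. ap f y * ap f y)"
    using assms by (intro unit_valued_mult)
  then have "mean (\<lambda>y. ap f y * ap f y) \<le> mean (\<lambda>_. 1)"
    unfolding unit_valued_def by (intro mean_mono) auto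
  then show ?thesis
    by (simp add: nm_def corr_def mean_const)
qed

lemma mean_replace:
  assumes "unit_valued h" "unit_valued G" "unit_valued F" "nm (bfun G - bfun F) \<le> \<kappa>"
  shows "mean (\<lambda>y. h y * F y) - \<kappa> \<le> mean (\<lambda>y. h y * G y)"
proof -
  note b = unit_valued_bdd[OF assms(1)] unit_valued_bdd[OF assms(2)] unit_valued_bdd[OF assms(3)]
  have "\<bar>corr (bfun h) (bfun G - bfun F)\<bar> \<le> nm (bfun h) * nm (bfun G - bfun F)"
    by (rule cauchy_schwarz)
  also have "\<dots> \<le> 1 * \<kappa>"
    using assms b by (intro mult_mono nm_le_one) auto
  finally have "\<bar>corr (bfun h) (bfun G) - corr (bfun h) (bfun F)\<bar> \<le> \<kappa>"
    by (simp add: ip_diff_right)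
  then show ?thesis
    using b by (simp add: corr_def abs_le_iff)
qed

text \<open>One factor is exchanged at a time, by Cauchy-Schwarz at cost \<open>\<kappa>\<close>;
  \<open>h\<close> is arbitrary so that it can absorb the factors already exchanged.\<close>

lemma mean_replace_prod:
  assumes "finite I" "unit_valued h" "unit_valued F"
    and "\<And>i. i \<in> I \<Longrightarrow> unit_valued (G i) \<and> nm (bfun (G i) - bfun F) \<le> \<kappa>"
  shows "mean (\<lambda>y. h y * F y ^ card I) - real (card I) * \<kappa> \<le> mean (\<lambda>y. h y * (\<Prod>i\<in>I. G i y))"
  using assms
proof (induction I arbitrary: h rule: finite_induct)
  case (insert j I)
  have Gj: "unit_valued (G j)" "nm (bfun (G j) - bfun F) \<le> \<kappa>"
    using insert.prems by auto
  have "mean (\<lambda>y. (h y * G j y) * F y ^ card I) - real (card I) * \<kappa>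
      \<le> mean (\<lambda>y. (h y * G j y) * (\<Prod>i\<in>I. G i y))"
    using insert.prems by (intro insert.IH unit_valued_mult) auto
  moreover have "mean (\<lambda>y. (h y * F y ^ card I) * F y) - \<kappa> \<le> mean (\<lambda>y. (h y * F y ^ card I) * G j y)"
    using insert.prems Gj by (intro mean_replace unit_valued_mult unit_valued_power)
  ultimately show ?case
    using insert.hyps by (simp add: algebra_simps)
qed simp

text \<open>The averages are opened one by one: a positive correlation with an average gives a
  positive correlation with one of its translates, which is then absorbed into
  \<open>h\<close>.\<close>

lemma exists_shifts:
  assumes "finite I" "unit_valued h" "unit_valued (ap f)"
    and "\<And>i. i \<in> I \<Longrightarrow> avop (D i) (T i)"
    and "0 < mean (\<lambda>y. h y * (\<Prod>i\<in>I. ap (T i f) y))"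
  shows "\<exists>x. (\<forall>i\<in>I. x i \<in> D i) \<and> 0 < mean (\<lambda>y. h y * (\<Prod>i\<in>I. ap f (y + x i)))"
  using assms
proof (induction I arbitrary: h rule: finite_induct)
  case (insert j I)
  define g where "g y = h y * (\<Prod>i\<in>I. ap (T i f) y)" for y
  have "unit_valued g"
    unfolding g_def using insert.prems
    by (intro unit_valued_mult unit_valued_prod) (auto intro: avop_unit_valued)
  then have g: "bdd_fun g"
    by (rule unit_valued_bdd)
  have "\<exists>z\<in>D j. 0 < corr (bfun g) (shift z f)"
  proof (rule ccontr)
    assume "\<not> ?thesis"
    then have "corr (bfun g) (shift z f) \<le> 0" if "z \<in> D j" for z
      using that by (simp add: not_less)
    with insert.prems(3)[OF insertI1] have "corr (bfun g) (T j f) \<le> 0"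
      by (rule avop_ip_le)
    moreover have "corr (bfun g) (T j f) = mean (\<lambda>y. h y * (\<Prod>i\<in>insert j I. ap (T i f) y))"
      using g insert.hyps by (simp add: corr_def g_def mult_ac)
    ultimately show False
      using insert.prems(4) by linarith
  qed
  then obtain z where z: "z \<in> D j" "0 < corr (bfun g) (shift z f)"
    by blast
  let ?h = "\<lambda>y. h y * ap f (y + z)"
  have "unit_valued (\<lambda>y. ap f (y + z))"
    using insert.prems(2) unfolding unit_valued_def by blast
  then have "unit_valued ?h"
    using insert.prems(1) by (rule unit_valued_mult[rotated])
  moreover have "0 < mean (\<lambda>y. ?h y * (\<Prod>i\<in>I. ap (T i f) y))"
    using z(2) g by (simp add: corr_def g_def mult_ac)
  ultimately obtain x where x: "\<forall>i\<in>I. x i \<in> D i" "0 < mean (\<lambda>y. ?h y * (\<Prod>i\<in>I. ap f (y + x i)))"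
    using insert.IH[of ?h] insert.prems by auto
  have "(\<Prod>i\<in>insert j I. ap f (y + (x(j := z)) i)) = ap f (y + z) * (\<Prod>i\<in>I. ap f (y + x i))" for y
  proof -
    have "(\<Prod>i\<in>I. ap f (y + (x(j := z)) i)) = (\<Prod>i\<in>I. ap f (y + x i))"
      using insert.hyps by (intro prod.cong) auto
    then show ?thesis
      using insert.hyps by simp
  qed
  then show ?case
    using x z by (intro exI[of _ "x(j := z)"]) (auto simp: mult.assoc)
qed simp

text \<open>Jensen's inequality: by Bernoulli the power lies above its tangent at
  \<open>c = mean F\<close>, and the mean of the tangent is \<open>c ^ n\<close>.\<close>

lemma mean_power_ge:
  assumes "unit_valued F" "0 < mean F"
  shows "mean F ^ n \<le> mean (\<lambda>y. F y ^ n)"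
proof -
  define c where "c = mean F"
  have c: "c > 0"
    using assms c_def by simp
  have tangent: "c ^ n * (1 - real n) + (real n * c ^ n / c) * F y \<le> F y ^ n" for y
  proof -
    have "-1 \<le> F y / c - 1"
      using assms c unfolding unit_valued_def by simp
    then have "1 + real n * (F y / c - 1) \<le> (1 + (F y / c - 1)) ^ n"
      by (rule Bernoulli_inequality)
    then have "c ^ n * (1 + real n * (F y / c - 1)) \<le> c ^ n * (F y / c) ^ n"
      using c by (intro mult_left_mono) auto
    then show ?thesis
      using c by (simp add: power_divide algebra_simps)
  qed
  have F: "bdd_fun F" "bdd_fun (\<lambda>y. F y ^ n)"
    using assms unit_valued_power unit_valued_bdd by blast+
  have cF: "bdd_fun (\<lambda>y. (real n * c ^ n / c) * F y)"
    by (intro bdd_fun_mult bdd_fun_const F(1))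
  have "c ^ n = c ^ n * (1 - real n) + (real n * c ^ n / c) * mean F"
    using c by (simp add: c_def[symmetric] field_simps)
  also have "\<dots> = mean (\<lambda>y. c ^ n * (1 - real n)) + mean (\<lambda>y. (real n * c ^ n / c) * F y)"
    by (simp only: mean_const mean_scale[OF F(1)])
  also have "\<dots> = mean (\<lambda>y. c ^ n * (1 - real n) + (real n * c ^ n / c) * F y)"
    by (rule mean_add[symmetric, OF bdd_fun_const cF])
  also have "\<dots> \<le> mean (\<lambda>y. F y ^ n)"
  proof (rule mean_mono)
    have "(\<lambda>y. c ^ n * (1 - real n) + (real n * c ^ n / c) * F y)
        = ap (bfun (\<lambda>_. c ^ n * (1 - real n)) + (real n * c ^ n / c) *\<^sub>R bfun F)"
      using F by (simp add: fun_eq_iff)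
    then show "bdd_fun (\<lambda>y. c ^ n * (1 - real n) + (real n * c ^ n / c) * F y)"
      by (simp only: bdd_fun_ap)
  qed (use F tangent in auto)
  finally show ?thesis
    by (simp add: c_def)
qed

end

section \<open>Recurrence along orbits of the group\<close>

locale twisted_recurrence = invariant_mean M + unipotent_group \<Gamma> S
  for M :: "'n::finite bfun \<Rightarrow> real" and \<Gamma> S :: "(int^'n^'n) set"
begin

text \<open>The path and the lattice multiplier \<open>q\<close> depend on \<open>a\<close>, but
  stability at level \<open>k * (k' * q)\<close> makes that harmless. The three
  \<open>\<eta>\<close> pay for stability, for a near minimiser at that level, and for the slack of
  the polynomial average. Restricting the orbit to \<open>scal k UNIV\<close> keeps \<open>T\<close>
  comparable with near minimisers at level \<open>k\<close>.\<close>

lemma orbit_average_near: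
  assumes f: "nm f \<le> 1" and \<eta>: "\<eta> > 0" and k: "k \<ge> 1"
    and stable: "\<And>k'. k' \<ge> 1 \<Longrightarrow> energy (scal (k * k') UNIV) f \<le> energy (scal k UNIV) f + \<eta>"
    and a: "a \<in> scal k UNIV" "a \<noteq> 0"
  shows "\<exists>T. avop ({\<gamma> *v a | \<gamma>. \<gamma> \<in> \<Gamma>} \<inter> scal k UNIV) T \<and>
    corr (T f) (T f) \<le> energy (scal k UNIV) f + 3 * \<eta>"
proof -
  let ?e = "energy (scal k UNIV) f"
  obtain ws J where walk: "\<forall>n. \<exists>\<gamma>\<in>\<Gamma>. pval ws J n = \<gamma> *v a"
    and full: "span (rvec ` ws ` {1..J}) = UNIV"
    using spanning_walk[OF a(2)] by blast
  obtain q where q: "q \<ge> 1" "\<And>x. int q *s x \<in> lattice_span ws J"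
    using full_rank_lattice[OF full] by metis
  have e: "0 \<le> ?e"
    unfolding energy_def
  proof (rule cInf_greatest)
    have "avop (scal k UNIV) (shift a)"
      using a(1) by (rule avop_base)
    then show "(\<lambda>T. corr (T f) (T f)) ` {T. avop (scal k UNIV) T} \<noteq> {}"
      by blast
  qed (use ip_ge_zero in auto)
  define \<beta> where "\<beta> = sqrt (?e + 2 * \<eta>)"
  define \<epsilon> where "\<epsilon> = sqrt (?e + 3 * \<eta>) - \<beta>"
  have \<epsilon>: "\<epsilon> > 0"
    using e \<eta> by (simp add: \<epsilon>_def \<beta>_def)
  have "\<exists>T. avop (scal k' (lattice_span ws J)) T \<and> nm (T f) \<le> \<beta>" if "k' \<ge> 1" for k'
  proof -
    have "0 \<in> scal (k * (k' * q)) UNIV"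
      by (simp add: zero_in_scal)
    then obtain T where T: "avop (scal (k * (k' * q)) UNIV) T"
      "corr (T f) (T f) \<le> energy (scal (k * (k' * q)) UNIV) f + \<eta>"
      using energy_near[OF _ \<eta>] by metis
    have "energy (scal (k * (k' * q)) UNIV) f \<le> ?e + \<eta>"
      using that q by (intro stable) simp
    then have "nm (T f) \<le> \<beta>"
      unfolding nm_def \<beta>_def using T(2) by simp
    moreover have "scal (k * (k' * q)) UNIV \<subseteq> scal k' (lattice_span ws J)"
    proof
      fix y :: "int^'n" assume "y \<in> scal (k * (k' * q)) UNIV"
      then obtain x where "y = int (k * (k' * q)) *s x"
        unfolding scal_def by blast
      then have "y = int k' *s (int k *s (int q *s x))"
        by (simp add: vec_eq_iff ac_simps)
      moreover have "int k *s (int q *s x) \<in> lattice_span ws J"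
        by (intro lattice_span_smult q)
      ultimately show "y \<in> scal k' (lattice_span ws J)"
        unfolding scal_def by blast
    qed
    ultimately show ?thesis
      using avop_mono[OF T(1)] by blast
  qed
  then obtain K where K: "\<forall>K'\<ge>1. \<forall>\<^sub>F N in sequentially.
      nm (avg N (\<lambda>n. shift (pval ws J (K * K' * n)) f)) \<le> \<beta> + \<epsilon>"
    using polynomial_average_le[OF f \<epsilon>] by blast
  have "\<forall>\<^sub>F N in sequentially. N > 0 \<and> nm (avg N (\<lambda>n. shift (pval ws J (K * 1 * n)) f)) \<le> \<beta> + \<epsilon>"
    by (intro eventually_conj eventually_gt_at_top K[rule_format]) simp
  then obtain N where N: "N > 0" "nm (avg N (\<lambda>n. shift (pval ws J (K * 1 * n)) f)) \<le> \<beta> + \<epsilon>"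
    using eventually_happens'[OF sequentially_bot] by blast
  let ?T = "\<lambda>v. avg N (\<lambda>n. shift (pval ws J (K * 1 * n)) v)"
  have "avop ({\<gamma> *v a | \<gamma>. \<gamma> \<in> \<Gamma>} \<inter> scal k UNIV) ?T"
  proof (rule avop_avg[OF _ N(1)])
    fix n
    obtain \<gamma> where \<gamma>: "\<gamma> \<in> \<Gamma>" "pval ws J (K * 1 * n) = \<gamma> *v a"
      using walk by blast
    obtain x where "a = int k *s x"
      using a(1) unfolding scal_def by blast
    then have "\<gamma> *v a = int k *s (\<gamma> *v x)"
      by (simp add: matrix_vector_mult_smult)
    then show "pval ws J (K * 1 * n) \<in> {\<gamma> *v a | \<gamma>. \<gamma> \<in> \<Gamma>} \<inter> scal k UNIV"
      unfolding \<gamma>(2) scal_def using \<gamma>(1) by blast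
  qed
  moreover have "corr (?T f) (?T f) \<le> ?e + 3 * \<eta>"
  proof -
    have "sqrt (corr (?T f) (?T f)) \<le> sqrt (?e + 3 * \<eta>)"
      using N(2) by (simp add: \<epsilon>_def nm_def)
    then show ?thesis by simp
  qed
  ultimately show ?thesis by blast
qed

lemma common_return:
  fixes m :: nat
  assumes B: "0 < M (bfun (\<lambda>y. if y \<in> B then 1 else 0))" and m: "m \<ge> 1"
  shows "\<exists>k::int. k > 0 \<and> (\<forall>a :: nat \<Rightarrow> int^'n. (\<forall>i<m. \<forall>j. k dvd a i $ j) \<longrightarrow>
    (\<exists>\<gamma> :: nat \<Rightarrow> int^'n^'n. \<exists>b\<in>B. (\<forall>i<m. \<gamma> i \<in> \<Gamma>) \<and> {\<gamma> i *v a i | i. i < m} \<subseteq> (\<lambda>c. c - b) ` B))"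
proof -
  define f :: "'n bfun" where "f = bfun (\<lambda>y. if y \<in> B then 1 else 0)"
  have ap_f: "ap f = (\<lambda>y. if y \<in> B then 1 else 0)"
    unfolding f_def by (intro ap_bfun bdd_fun_01) auto
  have f01: "unit_valued (ap f)"
    by (simp add: unit_valued_def ap_f)
  define c where "c = M f"
  have c: "0 < c" "c \<le> 1"
  proof -
    have "mean (ap f) \<le> mean (\<lambda>_. 1)"
      using f01 unfolding unit_valued_def by (intro mean_mono) auto
    then show "c \<le> 1"
      by (simp add: c_def M_eq_mean mean_const)
  qed (use B in \<open>simp add: c_def f_def\<close>)
  \<comment> \<open>Two losses of at most \<open>m * \<kappa>\<close> occur, one in
    \<open>lower\<close> and one in \<open>mean_replace_prod\<close>; together they are at most half
    of \<open>c ^ (m + 1)\<close>. Then \<open>\<eta>\<close> solves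
    \<open>2 * sqrt (3 * \<eta>) = \<kappa>\<close>, with \<open>3 * \<eta>\<close> the energy
    excess of an orbit average.\<close>
  define \<kappa> where "\<kappa> = c ^ (m + 1) / (4 * real m)"
  define \<eta> where "\<eta> = \<kappa>\<^sup>2 / 12"
  have \<kappa>: "\<kappa> > 0"
    using c m by (simp add: \<kappa>_def)
  then have \<eta>: "\<eta> > 0"
    by (simp add: \<eta>_def)
  have sqrt3: "2 * sqrt (3 * \<eta>) = \<kappa>"
    using \<kappa> by (simp add: \<eta>_def real_sqrt_divide)
  obtain k :: nat where k: "k \<ge> 1" and stable:
    "\<And>k'. k' \<ge> 1 \<Longrightarrow> energy (scal (k * k') UNIV) f \<le> energy (scal k UNIV) f + \<eta>"
    using energy_stable[of UNIV \<eta> f] \<eta> by auto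
  let ?D = "scal k (UNIV :: (int^'n) set)"
  have "0 \<in> ?D"
    by (simp add: zero_in_scal)
  then obtain T0 where T0: "avop ?D T0" "corr (T0 f) (T0 f) \<le> energy ?D f + \<eta>"
    using energy_near[OF _ \<eta>] by metis
  define F where "F = T0 f"
  have F01: "unit_valued (ap F)"
    unfolding F_def using T0(1) f01 by (rule avop_unit_valued)
  have near: "nm (T f - F) \<le> \<kappa>" if "avop ?D T" "corr (T f) (T f) \<le> energy ?D f + 3 * \<eta>" for T
    unfolding F_def sqrt3[symmetric] using that T0 \<eta> by (intro energy_close) auto
  have F_shift: "nm (shift x F - F) \<le> \<kappa>" if "x \<in> ?D" for x
  proof -
    have "avop ?D (\<lambda>v. shift x (T0 v))"
      using T0(1) by (rule avop_shift) (use scal_add that in blast)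
    then show ?thesis
      using near[of "\<lambda>v. shift x (T0 v)"] T0(2) \<eta> by (simp add: U_ip F_def)
  qed
  \<comment> \<open>\<open>mean (F ^ (r + 1))\<close> is the correlation of \<open>F ^ r\<close>
    with an average of translates of \<open>f\<close>. For a single translate by \<open>x\<close>,
    replacing each \<open>F\<close> by its translate costs \<open>\<kappa>\<close>, and shift
    invariance then gives \<open>mean (f * F ^ r)\<close>.\<close>
  have lower: "c ^ (r + 1) - real r * \<kappa> \<le> mean (\<lambda>y. ap f y * ap F y ^ r)" for r
  proof -
    let ?h = "bfun (\<lambda>y. ap F y ^ r)"
    have h: "ap ?h = (\<lambda>y. ap F y ^ r)"
      using unit_valued_bdd[OF unit_valued_power[OF F01]] by simp
    have "corr ?h (shift x f) \<le> mean (\<lambda>y. ap f y * ap F y ^ r) + real r * \<kappa>" if "x \<in> ?D" for x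
    proof -
      have s01: "unit_valued (\<lambda>y. ap f (y + x))"
        using f01 unfolding unit_valued_def by blast
      have sF01: "unit_valued (ap (shift x F))"
        using F01 unfolding unit_valued_def by simp
      have "mean (\<lambda>y. ap f (y + x) * ap F y ^ card {..<r}) - real (card {..<r}) * \<kappa>
          \<le> mean (\<lambda>y. ap f (y + x) * (\<Prod>i\<in>{..<r}. ap (shift x F) y))"
      proof (rule mean_replace_prod[where G = "\<lambda>i :: nat. ap (shift x F)"])
        show "unit_valued (ap (shift x F)) \<and> nm (bfun (ap (shift x F)) - bfun (ap F)) \<le> \<kappa>" for i :: nat
          using sF01 F_shift[OF that] by simp
      qed (use s01 F01 in auto)
      also have "\<dots> = mean (\<lambda>y. ap f y * ap F y ^ r)"
        using mean_shift[of "\<lambda>y. ap f y * ap F y ^ r" x] unit_valued_bdd[OF unit_valued_power[OF F01]] by simp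
      finally show ?thesis
        by (simp add: corr_def h mult.commute)
    qed
    with T0(1) have "corr ?h (T0 f) \<le> mean (\<lambda>y. ap f y * ap F y ^ r) + real r * \<kappa>"
      by (rule avop_ip_le)
    moreover have "corr ?h (T0 f) = mean (\<lambda>y. ap F y ^ (r + 1))"
      by (simp add: corr_def h F_def[symmetric] mult.commute)
    moreover have "mean (ap F) = c"
      using avop_M[OF T0(1), of f] by (simp add: F_def c_def M_eq_mean)
    ultimately show ?thesis
      using mean_power_ge[OF F01, of "r + 1"] c by simp
  qed
  show ?thesis
  proof (intro exI[of _ "int k"] conjI allI impI)
    show "int k > 0"
      using k by simp
    fix a :: "nat \<Rightarrow> int^'n"
    assume dvd: "\<forall>i<m. \<forall>j. int k dvd a i $ j"
    \<comment> \<open>Zero vectors have no spanning path; for them the identity matrix serves,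
      because \<open>b \<in> B\<close>.\<close>
    define I where "I = {i. i < m \<and> a i \<noteq> 0}"
    have I: "finite I" "card I \<le> m"
      using card_mono[of "{..<m}" I] by (auto simp: I_def)
    let ?O = "\<lambda>i. {\<gamma> *v a i | \<gamma>. \<gamma> \<in> \<Gamma>} \<inter> ?D"
    have "\<exists>T. avop (?O i) T \<and> corr (T f) (T f) \<le> energy ?D f + 3 * \<eta>" if "i \<in> I" for i
    proof -
      have "a i = int k *s (\<chi> j. a i $ j div int k)"
        using dvd that by (simp add: vec_eq_iff I_def)
      then have "a i \<in> ?D"
        unfolding scal_def by blast
      then show ?thesis
        using that nm_le_one[OF f01] \<eta> k stable by (intro orbit_average_near) (auto simp: I_def)
    qed
    then have "\<forall>i\<in>I. \<exists>T. avop (?O i) T \<and> corr (T f) (T f) \<le> energy ?D f + 3 * \<eta>"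
      by (intro ballI)
    from bchoice[OF this] obtain T
      where T_all: "\<forall>i\<in>I. avop (?O i) (T i) \<and> corr (T i f) (T i f) \<le> energy ?D f + 3 * \<eta>"
      by (elim exE)
    have T: "avop (?O i) (T i)" and energy_T: "corr (T i f) (T i f) \<le> energy ?D f + 3 * \<eta>"
      if "i \<in> I" for i
      using T_all that by auto
    have "mean (\<lambda>y. ap f y * ap F y ^ card I) - real (card I) * \<kappa> \<le> mean (\<lambda>y. ap f y * (\<Prod>i\<in>I. ap (T i f) y))"
    proof (intro mean_replace_prod conjI)
      fix i assume i: "i \<in> I"
      show "unit_valued (ap (T i f))"
        using T[OF i] f01 by (rule avop_unit_valued)
      show "nm (bfun (ap (T i f)) - bfun (ap F)) \<le> \<kappa>"
        using near[OF avop_mono[OF T[OF i]] energy_T[OF i]] by simp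
    qed (use I f01 F01 in auto)
    moreover have "2 * real (card I) * \<kappa> < c ^ (card I + 1)"
    proof -
      have "2 * real (card I) * \<kappa> \<le> 2 * real m * \<kappa>"
        using I \<kappa> by (intro mult_right_mono) auto
      also have "\<dots> = c ^ (m + 1) / 2"
        using m by (simp add: \<kappa>_def)
      also have "\<dots> < c ^ (m + 1)"
        using c by simp
      also have "\<dots> \<le> c ^ (card I + 1)"
        using c I by (intro power_decreasing) auto
      finally show ?thesis .
    qed
    ultimately have pos: "0 < mean (\<lambda>y. ap f y * (\<Prod>i\<in>I. ap (T i f) y))"
      using lower[of "card I"] by linarith
    obtain x where x: "\<forall>i\<in>I. x i \<in> ?O i" "0 < mean (\<lambda>y. ap f y * (\<Prod>i\<in>I. ap f (y + x i)))"
      using exists_shifts[OF I(1) f01 f01 T pos] by blast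
    have "\<exists>b. 0 < ap f b * (\<Prod>i\<in>I. ap f (b + x i))"
    proof (rule ccontr)
      assume "\<not> ?thesis"
      then have le: "ap f b * (\<Prod>i\<in>I. ap f (b + x i)) \<le> 0" for b
        by (simp add: not_less)
      have "unit_valued (\<lambda>y. ap f y * (\<Prod>i\<in>I. ap f (y + x i)))"
        using f01 by (intro unit_valued_mult unit_valued_prod) (auto simp: unit_valued_def)
      then have "mean (\<lambda>y. ap f y * (\<Prod>i\<in>I. ap f (y + x i))) \<le> mean (\<lambda>_. 0)"
        using le by (intro mean_mono bdd_fun_const) (auto intro: unit_valued_bdd)
      then show False
        using x(2) by (simp add: mean_const)
    qed
    then obtain b where b: "0 < ap f b * (\<Prod>i\<in>I. ap f (b + x i))"
      by blast
    have bB: "b \<in> B"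
      using b by (simp add: ap_f split: if_splits)
    have xB: "b + x i \<in> B" if "i \<in> I" for i
    proof (rule ccontr)
      assume "b + x i \<notin> B"
      then have "(\<Prod>i\<in>I. ap f (b + x i)) = 0"
        using that I(1) by (intro prod_zero) (auto simp: ap_f)
      then show False
        using b by simp
    qed
    have "\<forall>i. \<exists>g\<in>\<Gamma>. i < m \<longrightarrow> b + g *v a i \<in> B"
    proof
      fix i
      show "\<exists>g\<in>\<Gamma>. i < m \<longrightarrow> b + g *v a i \<in> B"
      proof (cases "i \<in> I")
        case True
        then obtain g where "g \<in> \<Gamma>" "x i = g *v a i"
          using x(1) by blast
        then show ?thesis
          using xB[OF True] by auto
      next
        case False
        then have "i < m \<longrightarrow> a i = 0"
          by (simp add: I_def)
        then show ?thesis
          using bB group_one by (intro bexI[of _ "mat 1"]) auto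
      qed
    qed
    then obtain \<gamma> where \<gamma>: "\<And>i. \<gamma> i \<in> \<Gamma>" "\<And>i. i < m \<Longrightarrow> b + \<gamma> i *v a i \<in> B"
      by metis
    have "\<gamma> i *v a i \<in> (\<lambda>c. c - b) ` B" if "i < m" for i
      using \<gamma>(2)[OF that] by (intro image_eqI[of _ _ "b + \<gamma> i *v a i"]) auto
    then show "\<exists>\<gamma>. \<exists>b\<in>B. (\<forall>i<m. \<gamma> i \<in> \<Gamma>) \<and> {\<gamma> i *v a i | i. i < m} \<subseteq> (\<lambda>c. c - b) ` B"
      using \<gamma>(1) bB by (intro exI[of _ \<gamma>] bexI[of _ b]) auto
  qed
qed

end

theorem theorem1p5:
  fixes \<Gamma> :: "('n::finite) intmat set"
    and S :: "'n intmat set"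
    and B :: "(int^'n) set"
    and m :: nat
  assumes d2: "CARD('n) \<ge> 2"
    and subgrp: "is_subgroup_GL \<Gamma>"
    and irred: "irreducible_action \<Gamma>"
    and S_fin: "finite S"
    and S_sub: "S \<subseteq> \<Gamma>"
    and S_unip: "\<forall>s\<in>S. unipotent s"
    and S_gen: "generated_group S = \<Gamma>"
    and dens: "upper_banach_density B > 0"
    and m1: "m \<ge> 1"
  shows "\<exists>k::int. k > 0 \<and>
     (\<forall>a :: nat \<Rightarrow> int^'n. (\<forall>i<m. \<forall>j. k dvd a i $ j) \<longrightarrow>
        (\<exists>\<gamma> :: nat \<Rightarrow> 'n intmat. \<exists>b\<in>B. (\<forall>i<m. \<gamma> i \<in> \<Gamma>) \<and>
            {\<gamma> i *v a i | i. i < m} \<subseteq> (\<lambda>c. c - b) ` B))"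
proof -
  obtain M where "invariant_mean M" and B: "0 < M (bfun (\<lambda>y. if y \<in> B then 1 else 0))"
    using exists_invariant_mean[OF dens] by blast
  moreover have "unipotent_group \<Gamma> S"
    using d2 subgrp irred S_sub S_unip S_gen by unfold_locales auto
  ultimately interpret twisted_recurrence M \<Gamma> S
    by (intro twisted_recurrence.intro)
  show ?thesis
    using common_return[OF B m1] .
qed

end
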